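(* Let $1\le m\le n-1$ be integers, let $S\subseteq\mathbf R^n$, let $\mathbf W_0:S\to\mathbf G(n,m)$ be Lipschitz and let $A\subseteq S$ be Borel. Write $\mathbf W(x)=x+\mathbf W_0(x)$ for $x\in S$. The following are equivalent. (1) $\mathcal L^n(A)=0$; (2) for $\mathcal L^n$ almost every $x\in A$, $\mathcal H^m(A\cap\mathbf W(x))=0$; (3) for $\mathcal L^n$ almost every $x\in S$, $\mathcal H^m(A\cap\mathbf W(x))=0$.
   Context: $\mathcal L^n$ is the Lebesgue outer measure on $\mathbf R^n$ (so "for almost every $x\in S$" means outside a subset of $S$ of outer measure $0$; $S$ is an arbitrary subset of $\mathbf R^n$) and $\mathcal H^m$ the $m$-dimensional Hausdorff outer measure. $\mathbf G(n,m)$ is the Grassmannian of $m$-dimensional linear subspaces of $\mathbf R^n$, with the metric $d(W_1,W_2)=\|P_{W_1}-P_{W_2}\|$ (operator norm), where $P_W:\mathbf R^n\to\mathbf R^n$ is the orthogonal projection onto $W$. *)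

theory Defs
  imports "HOL-Analysis.Analysis"
begin

definition orth_proj :: "'a::euclidean_space set \<Rightarrow> 'a \<Rightarrow> 'a" where
  (* The span (equal to W for a subspace W) makes this a linear map for every set W, so
     that the distance below is nonnegative everywhere, as the locale Metric_space asks. *)
  "orth_proj W x = (THE y. y \<in> span W \<and> (\<forall>w\<in>span W. orthogonal (x - y) w))"

lemma orth_proj_eqI:
  fixes W :: "'a::euclidean_space set"
  assumes "y \<in> span W" "\<And>w. w \<in> span W \<Longrightarrow> orthogonal (x - y) w"
  shows "orth_proj W x = y"
  unfolding orth_proj_def
proof (rule the_equality)
  show "y \<in> span W \<and> (\<forall>w\<in>span W. orthogonal (x - y) w)"
    using assms by blast
next
  fix z assume z: "z \<in> span W \<and> (\<forall>w\<in>span W. orthogonal (x - z) w)"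
  then have zy: "z - y \<in> span W"
    using assms(1) span_diff by blast
  have "(x - y) \<bullet> (z - y) = 0" "(x - z) \<bullet> (z - y) = 0"
    using assms(2)[OF zy] z zy by (auto simp: orthogonal_def)
  then have "(z - y) \<bullet> (z - y) = 0"
    by (simp add: inner_diff_left)
  then show "z = y" by simp
qed

lemma
  fixes W :: "'a::euclidean_space set"
  shows orth_proj_in_span: "orth_proj W x \<in> span W"
    and orthogonal_orth_proj: "w \<in> span W \<Longrightarrow> orthogonal (x - orth_proj W x) w"
proof -
  obtain y z where yz: "y \<in> span W" "\<And>w. w \<in> span W \<Longrightarrow> orthogonal z w" "x = y + z"
    using orthogonal_subspace_decomp_exists[of W x] by metis
  then have "orth_proj W x = y"
    by (intro orth_proj_eqI) auto
  with yz show "orth_proj W x \<in> span W"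
    and "w \<in> span W \<Longrightarrow> orthogonal (x - orth_proj W x) w" by auto
qed

lemma linear_orth_proj: "linear (orth_proj (W :: 'a::euclidean_space set))"
proof (rule linearI)
  fix x y :: 'a and c :: real
  have eq: "x + y - (orth_proj W x + orth_proj W y) = (x - orth_proj W x) + (y - orth_proj W y)"
    by simp
  show "orth_proj W (x + y) = orth_proj W x + orth_proj W y"
    by (rule orth_proj_eqI)
      (auto simp: eq intro!: span_add orth_proj_in_span orthogonal_clauses orthogonal_orth_proj)
  have eq: "c *\<^sub>R x - c *\<^sub>R orth_proj W x = c *\<^sub>R (x - orth_proj W x)"
    by (simp add: scaleR_diff_right)
  show "orth_proj W (c *\<^sub>R x) = c *\<^sub>R orth_proj W x"
    by (rule orth_proj_eqI)
      (auto simp only: eq intro!: span_scale orth_proj_in_span orthogonal_clauses orthogonal_orth_proj)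
qed

lemma orth_proj_eq_self_iff: "orth_proj W x = x \<longleftrightarrow> x \<in> span (W :: 'a::euclidean_space set)"
proof
  assume "orth_proj W x = x"
  then show "x \<in> span W" using orth_proj_in_span[of W x] by simp
next
  assume "x \<in> span W"
  then show "orth_proj W x = x"
    by (intro orth_proj_eqI) (auto simp: orthogonal_def)
qed

definition grassmannian :: "nat \<Rightarrow> 'a::euclidean_space set set" where
  "grassmannian m = {W. subspace W \<and> dim W = m}"

definition grassmannian_dist :: "'a::euclidean_space set \<Rightarrow> 'a set \<Rightarrow> real" where
  "grassmannian_dist V W = onorm (\<lambda>x. orth_proj V x - orth_proj W x)"

definition grassmannian_metric :: "nat \<Rightarrow> 'a::euclidean_space set metric" where
  "grassmannian_metric m = metric (grassmannian m, grassmannian_dist)"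

lemma Metric_space_grassmannian:
  "Metric_space (grassmannian m) (grassmannian_dist :: 'a::euclidean_space set \<Rightarrow> _)"
proof
  have bl: "bounded_linear (\<lambda>x. orth_proj V x - orth_proj W x)" for V W :: "'a set"
    by (intro linear_linear[THEN iffD2] linear_compose_sub linear_orth_proj)
  fix U V W :: "'a set"
  show "0 \<le> grassmannian_dist V W"
    unfolding grassmannian_dist_def by (rule onorm_pos_le[OF bl])
  show "grassmannian_dist V W = grassmannian_dist W V"
    unfolding grassmannian_dist_def
    using onorm_neg[of "\<lambda>x. orth_proj V x - orth_proj W x"] by simp
  show "grassmannian_dist U W \<le> grassmannian_dist U V + grassmannian_dist V W"
    unfolding grassmannian_dist_def using onorm_triangle[OF bl[of U V] bl[of V W]] by simp
  assume VW: "V \<in> grassmannian m" "W \<in> grassmannian m"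
  then have span: "span V = V" "span W = W"
    by (auto simp: grassmannian_def span_eq_iff)
  show "grassmannian_dist V W = 0 \<longleftrightarrow> V = W"
  proof
    assume "grassmannian_dist V W = 0"
    then have "orth_proj V x = orth_proj W x" for x
      using onorm_eq_0[OF bl[of V W]] by (simp add: grassmannian_dist_def)
    then have "x \<in> span V \<longleftrightarrow> x \<in> span W" for x
      using orth_proj_eq_self_iff[of V x] orth_proj_eq_self_iff[of W x] by simp
    then show "V = W" using span by blast
  qed (simp add: grassmannian_dist_def onorm_zero)
qed

lemma mspace_grassmannian_metric [simp]: "mspace (grassmannian_metric m) = grassmannian m"
  unfolding grassmannian_metric_def
  by (rule Metric_space.mspace_metric[OF Metric_space_grassmannian])

lemma mdist_grassmannian_metric [simp]: "mdist (grassmannian_metric m) = grassmannian_dist"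
  unfolding grassmannian_metric_def
  by (rule Metric_space.mdist_metric[OF Metric_space_grassmannian])

text \<open>
  Hausdorff outer measure, normalized by the volume of the \<open>m\<close>-dimensional unit ball. The library
  function \<^const>\<open>diameter\<close> is only meaningful on bounded sets, whence the boundedness condition on
  the covers; finite covers are included since members may be empty, and the case distinction keeps
  the empty set at weight zero also when \<open>m = 0\<close>.
\<close>

definition hausdorff_weight :: "nat \<Rightarrow> 'a::metric_space set \<Rightarrow> ennreal" where
  "hausdorff_weight m C =
     (if C = {} then 0 else ennreal (unit_ball_vol (real m) * (diameter C / 2) ^ m))"

definition hausdorff_content :: "real \<Rightarrow> nat \<Rightarrow> 'a::metric_space set \<Rightarrow> ennreal" where
  "hausdorff_content \<delta> m A =
     (INF C \<in> {C :: nat \<Rightarrow> 'a set. A \<subseteq> (\<Union>i. C i) \<and> (\<forall>i. bounded (C i) \<and> diameter (C i) \<le> \<delta>)}.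
        \<Sum>i. hausdorff_weight m (C i))"

definition hausdorff_measure :: "nat \<Rightarrow> 'a::metric_space set \<Rightarrow> ennreal" where
  "hausdorff_measure m A = (SUP \<delta>\<in>{0<..}. hausdorff_content \<delta> m A)"

text \<open>Almost everywhere on an arbitrary, possibly non-measurable, set.\<close>

definition ae_on :: "'a::euclidean_space set \<Rightarrow> ('a \<Rightarrow> bool) \<Rightarrow> bool" where
  "ae_on S P \<longleftrightarrow> (\<exists>N\<subseteq>S. outer_measure_of lborel N = 0 \<and> (\<forall>x\<in>S - N. P x))"

end

theory Submission
  imports Defs
begin

text \<open>
  Extend the entries of the matrix of the orthogonal projection onto \<open>W0 x\<close> to Lipschitz functions
  on the whole space, giving a matrix field \<open>P\<close>, and put \<open>\<Psi> u x = x + P x u\<close>. For \<open>x \<in> S\<close>, the set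
  \<open>A \<inter> W x\<close> is Hausdorff null iff \<open>\<Psi> u x \<notin> A\<close> for almost every \<open>u\<close>. By Fubini's theorem it
  remains to study the maps \<open>\<Psi> u\<close> for fixed \<open>u\<close>.

  If \<open>A\<close> is null, then so is its preimage under \<open>\<Psi> u\<close> for almost every \<open>u\<close>: by Rademacher's theorem
  \<open>P\<close> is differentiable at almost every \<open>x\<close>, and there the derivative of \<open>\<Psi> (t u)\<close> is singular for
  finitely many \<open>t\<close> only, being of the form \<open>1 + t G\<close>; off the singular points \<open>\<Psi> u\<close> is injective
  with Lipschitz inverse on countably many pieces. If \<open>A\<close> is not null, then for small \<open>u\<close> the map
  \<open>\<Psi> u\<close> is a bi-Lipschitz perturbation of the identity and therefore maps a non-null part of \<open>A\<close>
  into \<open>A\<close>.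
\<close>

subsection \<open>Covering and measure estimates\<close>

text \<open>Conditions (2) and (3) speak of null sets in planes that vary with \<open>x\<close>.
  Pulling back under the projections turns all of them into Lebesgue null sets of one space, and
  only then does Fubini's theorem apply to pairs \<open>(x, u)\<close>. Since \<open>S\<close> is
  arbitrary, \<open>W0\<close> alone need not give a measurable set of pairs; the extension to the
  whole space does, at the price that off \<open>S\<close> the matrices need not be projections.
  Hence the maps \<Psi> are studied for arbitrary Lipschitz matrix fields. For one fixed
  \<open>u\<close> the map may collapse sets of positive measure, so \<open>u\<close> has to vary;
  lines through the origin suffice because \<open>det (1 + t G)\<close> is a polynomial in
  \<open>t\<close> with value 1 at \<open>t = 0\<close>. Only null sets and fixed positive fractions
  of measure matter, so crude constants do: the factor 5 of the Vitali covering lemma, doubled where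
  a diameter replaces a radius, stands in for sharp area formulas.\<close>

lemma vitali_covering_sequence:
  fixes T U :: "'a::euclidean_space set"
  assumes U: "open U" "T \<subseteq> U" and \<delta>: "0 < \<delta>"
  obtains a :: "nat \<Rightarrow> 'a" and \<rho> :: "nat \<Rightarrow> real"
  where "\<And>i. 0 \<le> \<rho> i" "\<And>i. \<rho> i \<le> \<delta>" "T \<subseteq> (\<Union>i. cball (a i) (5 * \<rho> i))"
    "(\<Sum>i. emeasure lborel (cball (a i) (\<rho> i))) \<le> emeasure lborel U"
proof -
  have "\<exists>e>0. e \<le> \<delta> \<and> cball x e \<subseteq> U" if xT: "x \<in> T" for x
  proof -
    obtain e where "e > 0" "cball x e \<subseteq> U"
      using U xT open_contains_cball_eq by blast
    then show ?thesis
      using \<delta> by (intro exI[of _ "min e \<delta>"]) (auto simp: subset_iff)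
  qed
  then obtain r where r: "\<And>x. x \<in> T \<Longrightarrow> 0 < r x \<and> r x \<le> \<delta> \<and> cball x (r x) \<subseteq> U"
    by metis
  have cov: "T \<subseteq> (\<Union>i\<in>T. cball i (r i))"
    using r by force
  obtain C where C: "countable C" "C \<subseteq> T"
    "pairwise (\<lambda>i j. disjnt (cball i (r i)) (cball j (r j))) C"
    "T \<subseteq> (\<Union>i\<in>C. cball i (5 * r i))"
    by (rule Vitali_covering_lemma_cballs[OF cov, of \<delta>]) (use r in auto)
  define I where "I = to_nat_on C ` C"
  define a where "a = from_nat_into C"
  \<comment> \<open>Indices outside \<open>I\<close> pad a possibly finite family to a sequence.
    Radius 0 makes the padding balls single points of measure 0; \<open>A\<close> replaces them by
    the empty set, since such a point may lie in a genuine ball and spoil disjointness.\<close>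
  define \<rho> where "\<rho> k = (if k \<in> I then r (a k) else 0)" for k
  have aC: "a k \<in> C" if "k \<in> I" for k
    using that C(1) by (auto simp: I_def a_def)
  define A where "A k = (if k \<in> I then cball (a k) (\<rho> k) else {})" for k
  have \<rho>0: "0 \<le> \<rho> k" "\<rho> k \<le> \<delta>" for k
    using r[of "a k"] aC[of k] C(2) \<delta> by (auto simp: \<rho>_def subset_iff less_imp_le)
  have emA: "emeasure lborel (cball (a k) (\<rho> k)) = emeasure lborel (A k)" for k
    by (auto simp: A_def \<rho>_def)
  have "disjoint_family A"
    unfolding disjoint_family_on_def
  proof (intro ballI impI)
    fix i j :: nat assume ij: "i \<noteq> j"
    show "A i \<inter> A j = {}"
    proof (cases "i \<in> I \<and> j \<in> I")
      case True
      then have "a i \<noteq> a j"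
        using ij C(1) by (auto simp: I_def a_def)
      then show ?thesis
        using True C(3) aC by (auto simp: A_def \<rho>_def pairwise_def disjnt_def)
    qed (auto simp: A_def)
  qed
  moreover have "range A \<subseteq> sets lborel"
    by (auto simp: A_def)
  ultimately have "(\<Sum>i. emeasure lborel (A i)) = emeasure lborel (\<Union>i. A i)"
    by (intro suminf_emeasure)
  also have "\<dots> \<le> emeasure lborel U"
  proof (intro emeasure_mono UN_least)
    show "A i \<subseteq> U" for i
      using r[of "a i"] aC[of i] C(2) by (auto simp: A_def \<rho>_def subset_iff)
  qed (use U in auto)
  finally have "(\<Sum>i. emeasure lborel (cball (a i) (\<rho> i))) \<le> emeasure lborel U"
    by (simp add: emA)
  moreover have "T \<subseteq> (\<Union>i. cball (a i) (5 * \<rho> i))"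
  proof
    fix x assume "x \<in> T"
    then obtain c where c: "c \<in> C" "x \<in> cball c (5 * r c)"
      using C(4) by blast
    then have "to_nat_on C c \<in> I" "a (to_nat_on C c) = c"
      using C(1) by (auto simp: I_def a_def)
    then show "x \<in> (\<Union>i. cball (a i) (5 * \<rho> i))"
      using c(2) by (intro UN_I[of "to_nat_on C c"]) (auto simp: \<rho>_def)
  qed
  ultimately show thesis
    using that \<rho>0 by blast
qed

lemma emeasure_cball_scale:
  fixes a b :: "'a::euclidean_space"
  assumes "0 \<le> c" "0 \<le> r"
  shows "emeasure lborel (cball a (c * r)) = ennreal (c ^ DIM('a)) * emeasure lborel (cball b r)"
  using assms by (simp add: emeasure_cball power_mult_distrib ennreal_mult'[symmetric] mult.left_commute)

lemma outer_open_le: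
  fixes T :: "'a::euclidean_space set"
  assumes T: "T \<in> sets borel" and e: "0 < (e::real)"
  obtains U where "open U" "T \<subseteq> U" "emeasure lborel U \<le> emeasure lborel T + e"
proof -
  obtain U where U: "open U" "T \<subseteq> U" "emeasure lborel (U - T) \<le> e"
    using outer_regular_lborel_le[OF T e] by blast
  have "emeasure lborel U = emeasure lborel (T \<union> (U - T))"
    using U by (intro arg_cong[where f = "emeasure lborel"]) auto
  also have "\<dots> \<le> emeasure lborel T + emeasure lborel (U - T)"
    using U T by (intro emeasure_subadditive) auto
  finally have "emeasure lborel U \<le> emeasure lborel T + e"
    using U(3) by (meson add_left_mono order.trans)
  then show thesis using that U by blast
qed

text \<open>A Vitali cover of \<open>T\<close> is transported by \<open>f\<close>: the part of
  \<open>T\<close> in a fivefold ball has diameter at most \<open>10 * \<rho> i\<close>, so its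
  image fits into a ball of radius \<open>10 * L * \<rho> i\<close>, while the original balls are
  disjoint in a tight open \<open>U\<close>. Measuring a Borel subset \<open>E\<close> of the image
  avoids any question about measurability of the image itself.\<close>

lemma emeasure_lipschitz_image_le:
  fixes f :: "'a::euclidean_space \<Rightarrow> 'a"
  assumes T: "T \<in> sets borel" and E: "E \<in> sets borel" "E \<subseteq> f ` T" and L: "L-lipschitz_on T f"
  shows "emeasure lborel E \<le> ennreal ((10 * L) ^ DIM('a)) * emeasure lborel T"
proof -
  have L0: "0 \<le> L" using L lipschitz_on_nonneg by blast
  have main: "emeasure lborel E \<le> ennreal ((10 * L) ^ DIM('a)) * (emeasure lborel T + e)" if e: "e > 0" for e :: real
  proof -
    obtain U where U: "open U" "T \<subseteq> U" "emeasure lborel U \<le> emeasure lborel T + e"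
      using outer_open_le[OF T e] by blast
    obtain a \<rho> where a: "\<And>i. 0 \<le> \<rho> i" "\<And>i. \<rho> i \<le> 1" "T \<subseteq> (\<Union>i. cball (a i) (5 * \<rho> i))"
      "(\<Sum>i. emeasure lborel (cball (a i) (\<rho> i))) \<le> emeasure lborel U"
      by (rule vitali_covering_sequence[OF U(1,2) zero_less_one]) (rule that; simp)
    have "\<exists>c. f ` (T \<inter> cball (a i) (5 * \<rho> i)) \<subseteq> cball c (10 * L * \<rho> i)" for i
    proof (cases "T \<inter> cball (a i) (5 * \<rho> i) = {}")
      case False
      \<comment> \<open>The image ball is centred at an image point: the Lipschitz bound holds on
        \<open>T\<close> only, and \<open>a i\<close> is not known to lie there.\<close>
      then obtain t where t: "t \<in> T" "t \<in> cball (a i) (5 * \<rho> i)" by auto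
      have "dist (f t) (f s) \<le> 10 * L * \<rho> i" if s: "s \<in> T" "s \<in> cball (a i) (5 * \<rho> i)" for s
      proof -
        have "dist (f t) (f s) \<le> L * dist t s"
          using L t s by (auto intro: lipschitz_onD)
        also have "dist t s \<le> 10 * \<rho> i"
          using t s dist_triangle[of t s "a i"] by (simp add: dist_commute)
        finally show ?thesis using L0 by (simp add: mult.assoc mult_left_mono mult.left_commute)
      qed
      then show ?thesis by (intro exI[of _ "f t"]) auto
    qed auto
    then obtain c where c: "\<And>i. f ` (T \<inter> cball (a i) (5 * \<rho> i)) \<subseteq> cball (c i) (10 * L * \<rho> i)"
      by metis
    have "E \<subseteq> (\<Union>i. cball (c i) (10 * L * \<rho> i))"
    proof
      fix y assume "y \<in> E"
      then obtain t where "t \<in> T" "y = f t" using E by blast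
      moreover then obtain i where "t \<in> cball (a i) (5 * \<rho> i)" using a(3) by blast
      ultimately show "y \<in> (\<Union>i. cball (c i) (10 * L * \<rho> i))"
        using c by blast
    qed
    then have "emeasure lborel E \<le> emeasure lborel (\<Union>i. cball (c i) (10 * L * \<rho> i))"
      by (intro emeasure_mono) auto
    also have "\<dots> \<le> (\<Sum>i. emeasure lborel (cball (c i) (10 * L * \<rho> i)))"
      by (rule emeasure_subadditive_countably) auto
    also have "\<dots> = (\<Sum>i. ennreal ((10 * L) ^ DIM('a)) * emeasure lborel (cball (a i) (\<rho> i)))"
      using a L0 by (intro suminf_cong emeasure_cball_scale) auto
    also have "\<dots> = ennreal ((10 * L) ^ DIM('a)) * (\<Sum>i. emeasure lborel (cball (a i) (\<rho> i)))"
      by (simp add: ennreal_suminf_cmult)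
    also have "\<dots> \<le> ennreal ((10 * L) ^ DIM('a)) * (emeasure lborel T + e)"
      using a(4) U(3) by (intro mult_left_mono) auto
    finally show ?thesis .
  qed
  show ?thesis
  proof (rule ennreal_le_epsilon)
    fix e :: real assume "e > 0" 
    \<comment> \<open>Dividing by \<open>K + 1\<close> below covers \<open>L = 0\<close> as
      well.\<close>
    define K where "K = (10 * L) ^ DIM('a)"
    have K: "0 \<le> K" using L0 by (simp add: K_def)
    have "emeasure lborel E \<le> ennreal K * (emeasure lborel T + ennreal (e / (K + 1)))"
      using main[of "e / (K + 1)"] \<open>e > 0\<close> K by (simp add: K_def)
    also have "\<dots> = ennreal K * emeasure lborel T + ennreal (K * (e / (K + 1)))"
      using K \<open>e > 0\<close> by (simp add: distrib_left ennreal_mult'[symmetric])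
    also have "\<dots> \<le> ennreal K * emeasure lborel T + ennreal e"
      using K \<open>e > 0\<close> by (intro add_left_mono ennreal_leI) (simp add: field_simps)
    finally show "emeasure lborel E \<le> ennreal ((10 * L) ^ DIM('a)) * emeasure lborel T + e"
      by (simp add: K_def)
  qed
qed

lemma orth_proj_orthogonal_comp:
  fixes V :: "'a::euclidean_space set"
  assumes "subspace V"
  shows "orth_proj (orthogonal_comp V) u = u - orth_proj V u"
proof (rule orth_proj_eqI)
  have [simp]: "span V = V" "span (orthogonal_comp V) = orthogonal_comp V"
    using assms by (simp_all add: subspace_orthogonal_comp)
  have "u - orth_proj V u \<in> orthogonal_comp V"
    using orthogonal_orth_proj[of _ V u] by (auto simp: orthogonal_comp_def orthogonal_commute)
  then show "u - orth_proj V u \<in> span (orthogonal_comp V)"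
    by (rule span_base)
  show "orthogonal (u - (u - orth_proj V u)) w" if "w \<in> span (orthogonal_comp V)" for w
  proof -
    have "w \<in> orthogonal_comp V" "orth_proj V u \<in> V"
      using that orth_proj_in_span[of V u] by simp_all
    then show ?thesis by (auto simp: orthogonal_comp_def)
  qed
qed

text \<open>In an orthonormal basis adapted to \<open>V\<close> and its orthogonal complement the
  set lies in a box with \<open>dim V\<close> sides of length \<open>2 * d\<close> and the others of
  length \<open>2 * R\<close>. The point is that \<open>C\<close> is uniform in the position
  \<open>c\<close>.\<close>

lemma emeasure_slab_le:
  fixes V :: "'a::euclidean_space set"
  assumes V: "subspace V" and R: "0 \<le> R"
  shows "\<exists>C\<ge>0. \<forall>c d. 0 \<le> d \<longrightarrow>
    emeasure lborel {u. norm u \<le> R \<and> norm (orth_proj V u - c) \<le> d} \<le> ennreal (C * d ^ dim V)"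
proof -
  have sV: "span V = V" using V by simp
  obtain B1 where B1: "B1 \<subseteq> V" "pairwise orthogonal B1" "\<And>x. x \<in> B1 \<Longrightarrow> norm x = 1"
    "independent B1" "card B1 = dim V" "span B1 = V"
    using orthonormal_basis_subspace[OF V] by metis
  obtain B2 where B2: "B2 \<subseteq> orthogonal_comp V" "pairwise orthogonal B2" "\<And>x. x \<in> B2 \<Longrightarrow> norm x = 1"
    "span B2 = orthogonal_comp V"
    using orthonormal_basis_subspace[OF subspace_orthogonal_comp] by metis
  define B where "B = B1 \<union> B2"
  have B12: "orthogonal x y" if "x \<in> B1" "y \<in> B2" for x y
    using that B1(1) B2(1) by (auto simp: orthogonal_comp_def)
  have oB: "pairwise orthogonal B"
    using B1(2) B2(2) B12 unfolding B_def pairwise_def by (metis Un_iff orthogonal_commute)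
  have nB: "norm x = 1" if "x \<in> B" for x
    using that B1(3) B2(3) by (auto simp: B_def)
  have iB: "independent B"
    using pairwise_orthogonal_independent[OF oB] nB by force
  have "u \<in> span B" for u
  proof -
    have "orth_proj V u \<in> span B1" "u - orth_proj V u \<in> span B2"
      using orth_proj_in_span[of V u] orth_proj_in_span[of "orthogonal_comp V" u] B1(6) B2(4)
      using span_eq_iff[THEN iffD2, OF subspace_orthogonal_comp[of V]]
      by (simp_all add: sV orth_proj_orthogonal_comp[OF V])
    then have "orth_proj V u + (u - orth_proj V u) \<in> span B"
      unfolding B_def by (intro span_add) (meson in_mono span_mono sup_ge1 sup_ge2)+
    then show ?thesis by simp
  qed
  then have spB: "span B = UNIV" by auto
  have fB: "finite B" using iB independent_imp_finite by blast
  have cB: "card B = DIM('a)"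
    using dim_eq_card[of B UNIV] spB iB by simp
  then obtain \<phi> where \<phi>: "bij_betw \<phi> (Basis :: 'a set) B"
    using fB finite_same_card_bij[of "Basis :: 'a set" B] by auto
  have \<phi>B: "\<phi> i \<in> B" if "i \<in> Basis" for i
    using \<phi> that by (auto simp: bij_betw_def)
  define f where "f t = (\<Sum>i\<in>Basis. (t \<bullet> i) *\<^sub>R \<phi> i)" for t
  have "linear f"
    unfolding f_def by (rule linearI)
      (simp_all add: inner_left_distrib scaleR_add_left sum.distrib scaleR_sum_right)
  \<comment> \<open>\<open>f\<close> is in fact an isometry; a Lipschitz constant from linearity is
    enough, being absorbed into \<open>C\<close>.\<close>
  then obtain L where L: "L > 0" "\<And>x. norm (f x) \<le> L * norm x"
    using linear_bounded_pos by metis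
  have lip: "L-lipschitz_on T f" for T
    using L \<open>linear f\<close> by (intro lipschitz_onI) (auto simp: dist_norm simp flip: linear_diff)
  define I where "I = {i \<in> Basis. \<phi> i \<in> B1}"
  have \<phi>I: "bij_betw \<phi> I B1"
    using \<phi> by (auto simp: bij_betw_def I_def B_def inj_on_def image_iff)
  then have cI: "card I = dim V"
    using bij_betw_same_card B1(5) by metis
  define C where "C = (10 * L) ^ DIM('a) * (2 ^ dim V * (2 * R) ^ (card (Basis - I :: 'a set)))"
  have "emeasure lborel {u. norm u \<le> R \<and> norm (orth_proj V u - c) \<le> d} \<le> ennreal (C * d ^ dim V)"
    (is "emeasure lborel ?S \<le> _") if d: "0 \<le> d" for c d
  proof -
    define l h :: 'a where "l = (\<Sum>i\<in>Basis. (if i \<in> I then c \<bullet> \<phi> i - d else - R) *\<^sub>R i)"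
      and "h = (\<Sum>i\<in>Basis. (if i \<in> I then c \<bullet> \<phi> i + d else R) *\<^sub>R i)"
    have lh: "l \<bullet> i = (if i \<in> I then c \<bullet> \<phi> i - d else - R)"
      "h \<bullet> i = (if i \<in> I then c \<bullet> \<phi> i + d else R)" if "i \<in> Basis" for i
      using that by (simp_all add: l_def h_def)
    have "?S \<subseteq> f ` cbox l h"
    proof
      fix u assume u: "u \<in> ?S"
      define t where "t = (\<Sum>i\<in>Basis. (u \<bullet> \<phi> i) *\<^sub>R i)"
      have ti: "t \<bullet> i = u \<bullet> \<phi> i" if "i \<in> Basis" for i
        using that by (simp add: t_def)
      have "f t = (\<Sum>i\<in>Basis. (u \<bullet> \<phi> i) *\<^sub>R \<phi> i)"
        by (simp add: f_def ti)
      also have "\<dots> = (\<Sum>b\<in>B. (u \<bullet> b) *\<^sub>R b)"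
        by (rule sum.reindex_bij_betw[OF \<phi>])
      also have "\<dots> = u"
        using oB nB fB spB by (intro orthonormal_basis_expand) auto
      finally have "u = f t" by simp
      moreover have "l \<bullet> i \<le> t \<bullet> i \<and> t \<bullet> i \<le> h \<bullet> i" if i: "i \<in> Basis" for i
      proof (cases "i \<in> I")
        case True
        then have b: "\<phi> i \<in> B1" by (simp add: I_def)
        then have "(u - orth_proj V u) \<bullet> \<phi> i = 0"
          using orthogonal_orth_proj[of "\<phi> i" V u] B1(1) sV by (auto simp: orthogonal_def)
        then have "u \<bullet> \<phi> i - c \<bullet> \<phi> i = (orth_proj V u - c) \<bullet> \<phi> i"
          by (simp add: inner_diff_left)
        also have "\<bar>\<dots>\<bar> \<le> d"
          using Cauchy_Schwarz_ineq2[of "orth_proj V u - c" "\<phi> i"] B1(3)[OF b] u by simp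
        finally show ?thesis using True lh[OF i] ti[OF i] by (auto simp: abs_le_iff)
      next
        case False
        have "\<bar>u \<bullet> \<phi> i\<bar> \<le> R"
          using Cauchy_Schwarz_ineq2[of u "\<phi> i"] nB[OF \<phi>B[OF i]] u by simp
        then show ?thesis using False lh[OF i] ti[OF i] by (auto simp: abs_le_iff)
      qed
      ultimately show "u \<in> f ` cbox l h"
        by (auto simp: mem_box)
    qed
    moreover have "closed ?S"
      by (intro closed_Collect_conj closed_Collect_le continuous_intros
          linear_continuous_on_compose[OF _ linear_orth_proj])
    ultimately have "emeasure lborel ?S \<le> ennreal ((10 * L) ^ DIM('a)) * emeasure lborel (cbox l h)"
      using lip by (intro emeasure_lipschitz_image_le[where f = f]) auto
    also have "(\<Prod>i\<in>Basis. (h - l) \<bullet> i) = (\<Prod>i\<in>Basis. (if i \<in> I then 2 * d else 2 * R))"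
      by (rule prod.cong) (auto simp: lh inner_diff_left)
    then have "emeasure lborel (cbox l h) = ennreal (\<Prod>i\<in>Basis. (if i \<in> I then 2 * d else 2 * R))"
      using R d by (auto simp: emeasure_lborel_cbox_eq lh)
    also have "(\<Prod>i\<in>Basis. (if i \<in> I then 2 * d else 2 * R)) = (2 * d) ^ dim V * (2 * R) ^ (card (Basis - I :: 'a set))"
      by (subst prod.If_cases) (auto simp: cI[symmetric] I_def Int_def Diff_eq intro!: arg_cong2[where f = "(*)"] arg_cong2[where f = "(^)"] arg_cong[where f = card])
    also have "ennreal ((10 * L) ^ DIM('a)) * ennreal \<dots> = ennreal (C * d ^ dim V)"
      using L R d by (simp add: ennreal_mult'[symmetric] C_def power_mult_distrib mult_ac)
    finally show ?thesis .
  qed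
  moreover have "0 \<le> C" using L R by (simp add: C_def)
  ultimately show ?thesis by blast
qed

subsection \<open>Hausdorff null subsets of affine planes\<close>

lemma negligible_iff_outer_measure_of:
  fixes S :: "'a::euclidean_space set"
  shows "negligible S \<longleftrightarrow> outer_measure_of lborel S = 0"
proof
  assume "negligible S"
  then obtain N where N: "N \<in> null_sets lborel" "S \<subseteq> N"
    by (auto simp: negligible_iff_null_sets null_sets_completion_iff2)
  then have "outer_measure_of lborel S \<le> emeasure lborel N"
    using outer_measure_of_mono[of S N lborel] by (auto simp: null_sets_def)
  then show "outer_measure_of lborel S = 0"
    using N by (auto simp: null_sets_def)
next
  assume "outer_measure_of lborel S = 0"
  then obtain E where "E \<in> sets lborel" "S \<subseteq> E" "emeasure lborel E = 0"
    using outer_measure_of_attain[of S lborel] by auto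
  then show "negligible S"
    unfolding negligible_iff_null_sets null_sets_completion_iff2
    by (intro bexI[of _ E]) auto
qed

lemma negligible_borel_cover:
  fixes S :: "'a::euclidean_space set"
  assumes "\<And>e::real. 0 < e \<Longrightarrow> \<exists>T\<in>sets borel. S \<subseteq> T \<and> emeasure lborel T \<le> ennreal e"
  shows "negligible S"
proof -
  have *: "outer_measure_of lborel S \<le> 0 + ennreal e" if e: "0 < e" for e
  proof -
    obtain T where T: "T \<in> sets borel" "S \<subseteq> T" "emeasure lborel T \<le> ennreal e"
      using assms[OF e] by blast
    then have "outer_measure_of lborel S \<le> emeasure lborel T"
      using outer_measure_of_mono[of S T lborel] by simp
    with T show ?thesis by simp
  qed
  have "outer_measure_of lborel S \<le> 0"
    by (rule ennreal_le_epsilon) (rule *)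
  then show ?thesis by (simp add: negligible_iff_outer_measure_of)
qed

text \<open>The preimage of a set of diameter \<open>d\<close> under the projection lies in a slab
  of width of order \<open>d\<close> around a translate of the orthogonal complement. The bounded
  part of this slab has volume of order \<open>d ^ m\<close>, just like the Hausdorff weight, so
  covers of \<open>B\<close> of small weight pull back to covers of small measure.\<close>

lemma negligible_of_hausdorff_null:
  fixes B :: "'a::euclidean_space set"
  assumes V: "subspace V" "dim V = m" and B: "hausdorff_measure m B = 0"
  shows "negligible {u. x + orth_proj V u \<in> B}"
proof -
  \<comment> \<open>A whole slab has infinite volume in general, so \<open>u\<close> is first
    confined to a ball.\<close>
  have "negligible {u. norm u \<le> real R \<and> x + orth_proj V u \<in> B}" for R :: nat
  proof (rule negligible_borel_cover)
    fix e :: real assume e: "0 < e"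
    obtain K where K: "K \<ge> 0" "\<And>c d. 0 \<le> d \<Longrightarrow>
        emeasure lborel {u. norm u \<le> real R \<and> norm (orth_proj V u - c) \<le> d} \<le> ennreal (K * d ^ m)"
      using emeasure_slab_le[OF V(1), of "real R"] V(2) by auto
    define \<omega> where "\<omega> = unit_ball_vol (real m)"
    have \<omega>: "\<omega> > 0" by (simp add: \<omega>_def)
    \<comment> \<open>Chosen so that \<open>K * d ^ m = K' * (\<omega> * (d / 2) ^ m)\<close>, which
      is \<open>K'\<close> times the weight of a nonempty set of diameter \<open>d\<close>.\<close>
    define K' where "K' = K * 2 ^ m / \<omega>"
    have K': "0 \<le> K'" using K \<omega> by (simp add: K'_def)
    have "hausdorff_content 1 m B \<le> hausdorff_measure m B"
      unfolding hausdorff_measure_def by (intro SUP_upper) auto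
    then have "hausdorff_content 1 m B < ennreal (e / (K' + 1))"
      using B e K' by simp
    then obtain C :: "nat \<Rightarrow> 'a set" where C: "B \<subseteq> (\<Union>i. C i)" "\<And>i. bounded (C i)"
      "(\<Sum>i. hausdorff_weight m (C i)) < ennreal (e / (K' + 1))"
      unfolding hausdorff_content_def INF_less_iff by auto
    define c where "c i = (SOME y. y \<in> C i) - x" for i
    \<comment> \<open>Empty members need their own case: their weight is 0 even for
      \<open>m = 0\<close>, and the choice made in \<open>c\<close> is then arbitrary.\<close>
    define T where "T i = (if C i = {} then {}
      else {u. norm u \<le> real R \<and> norm (orth_proj V u - c i) \<le> diameter (C i)})" for i
    have "closed (T i)" for i
      unfolding T_def
      by (auto intro!: closed_Collect_conj closed_Collect_le continuous_intros
          linear_continuous_on_compose[OF _ linear_orth_proj])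
    then have T: "T i \<in> sets lborel" for i by auto
    have "emeasure lborel (T i) \<le> ennreal K' * hausdorff_weight m (C i)" for i
    proof (cases "C i = {}")
      case False
      then have "emeasure lborel (T i) \<le> ennreal (K * diameter (C i) ^ m)"
        using K(2)[of "diameter (C i)" "c i"] diameter_ge_0[OF C(2)] by (simp add: T_def)
      also have "K * diameter (C i) ^ m = K' * (\<omega> * (diameter (C i) / 2) ^ m)"
        using \<omega> by (simp add: K'_def power_divide)
      finally show ?thesis
        using False K' by (simp add: hausdorff_weight_def \<omega>_def ennreal_mult')
    qed (simp add: T_def)
    then have "(\<Sum>i. emeasure lborel (T i)) \<le> (\<Sum>i. ennreal K' * hausdorff_weight m (C i))"
      by (intro suminf_le) auto
    also have "\<dots> \<le> ennreal K' * ennreal (e / (K' + 1))"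
      using C(3) by (auto simp: ennreal_suminf_cmult intro!: mult_left_mono)
    also have "\<dots> \<le> ennreal e"
      using K' e by (simp add: ennreal_mult'[symmetric] field_simps)
    finally have "(\<Sum>i. emeasure lborel (T i)) \<le> ennreal e" .
    moreover have "emeasure lborel (\<Union>i. T i) \<le> (\<Sum>i. emeasure lborel (T i))"
      using T by (intro emeasure_subadditive_countably) auto
    moreover have "{u. norm u \<le> real R \<and> x + orth_proj V u \<in> B} \<subseteq> (\<Union>i. T i)"
    proof clarify
      fix u assume u: "norm u \<le> real R" "x + orth_proj V u \<in> B"
      then obtain i where i: "x + orth_proj V u \<in> C i" using C(1) by auto
      then have "(SOME y. y \<in> C i) \<in> C i" by (rule someI)
      then have "dist (x + orth_proj V u) (SOME y. y \<in> C i) \<le> diameter (C i)"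
        using i C(2) diameter_bounded_bound by blast
      then have "u \<in> T i"
        using u i by (auto simp: T_def c_def dist_norm algebra_simps)
      then show "u \<in> (\<Union>i. T i)" by blast
    qed
    ultimately show "\<exists>T\<in>sets borel. {u. norm u \<le> real R \<and> x + orth_proj V u \<in> B} \<subseteq> T
        \<and> emeasure lborel T \<le> ennreal e"
      using T by (intro bexI[of _ "\<Union>i. T i"]) auto
  qed
  then have "negligible (\<Union>R::nat. {u. norm u \<le> real R \<and> x + orth_proj V u \<in> B})"
    by (intro negligible_Union_nat)
  moreover have "(\<Union>R::nat. {u. norm u \<le> real R \<and> x + orth_proj V u \<in> B}) = {u. x + orth_proj V u \<in> B}"
    using real_arch_simple by auto
  ultimately show ?thesis by simp
qed

text \<open>
  A cover of the preimage by small balls restricts, on each translate \<open>V + w\<close>, to a cover of \<open>B\<close>;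
  averaging over \<open>w\<close> in the unit ball finds a translate that meets few of the balls.
\<close>

lemma hausdorff_null_of_negligible:
  fixes B :: "'a::euclidean_space set"
  assumes V: "subspace V" "dim V = m" and B: "B \<subseteq> (+) x ` V"
    and neg: "negligible {u. x + orth_proj V u \<in> B}"
  shows "hausdorff_measure m B = 0"
proof -
  let ?Q = "orth_proj (orthogonal_comp V)"
  let ?n = "DIM('a)"
  have sV: "span V = V" using V by simp
  have Q: "?Q u = u - orth_proj V u" for u
    by (rule orth_proj_orthogonal_comp[OF V(1)])
  have PV: "orth_proj V (v + ?Q w) = v" if "v \<in> V" for v w
  proof (rule orth_proj_eqI)
    show "v \<in> span V" using that by (rule span_base)
    show "orthogonal (v + ?Q w - v) z" if "z \<in> span V" for z
      using orthogonal_orth_proj[OF that] by (simp add: Q)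
  qed
  have Plip: "norm (orth_proj V u) \<le> norm u" for u
  proof -
    have "orthogonal (u - orth_proj V u) (orth_proj V u)"
      by (intro orthogonal_orth_proj orth_proj_in_span)
    then have "norm (orth_proj V u) ^ 2 \<le> norm ((u - orth_proj V u) + orth_proj V u) ^ 2"
      by (subst norm_add_Pythagorean) auto
    then show ?thesis by (simp add: norm_le_square power2_norm_eq_inner)
  qed
  have Pdist: "norm (orth_proj V u - orth_proj V u') \<le> norm (u - u')" for u u'
    using Plip[of "u - u'"] by (simp add: linear_diff[OF linear_orth_proj])
  have Qlip: "norm (?Q u - ?Q u') \<le> norm (u - u')" for u u'
  proof -
    have "orthogonal (?Q u - ?Q u') (orth_proj V u - orth_proj V u')"
      unfolding Q using orthogonal_orth_proj[of "orth_proj V u - orth_proj V u'" V] orth_proj_in_span[of V]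
      by (simp add: span_diff orthogonal_def inner_diff_left)
    then have "norm (?Q u - ?Q u') ^ 2 \<le> norm ((?Q u - ?Q u') + (orth_proj V u - orth_proj V u')) ^ 2"
      by (subst norm_add_Pythagorean) auto
    then show ?thesis by (simp add: Q power2_le_iff_abs_le)
  qed
  have dimQ: "m + dim (orthogonal_comp V) = ?n"
    using dim_subspace_orthogonal_to_vectors[OF V(1) subspace_UNIV subset_UNIV] V(2)
    by (simp add: orthogonal_comp_def orthogonal_commute)
  obtain K where K: "K \<ge> 0" "\<And>c d. 0 \<le> d \<Longrightarrow>
      emeasure lborel {u. norm u \<le> 1 \<and> norm (?Q u - c) \<le> d} \<le> ennreal (K * d ^ dim (orthogonal_comp V))"
    using emeasure_slab_le[OF subspace_orthogonal_comp, of 1 V] by auto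
  define \<omega> where "\<omega> = unit_ball_vol (real m)"
  define \<Omega> where "\<Omega> = unit_ball_vol (real ?n)"
  have \<omega>: "\<omega> > 0" "\<Omega> > 0" by (simp_all add: \<omega>_def \<Omega>_def)
  \<comment> \<open>With \<open>s i = 5 * \<rho> i\<close>, the product of \<open>s i ^ m\<close>
    and the slab bound for the complementary dimension is \<open>K * 5 ^ ?n * \<rho> i ^ ?n\<close>,
    that is \<open>K'\<close> times the volume of the original ball.\<close>
  define K' where "K' = K * 5 ^ ?n / \<Omega>"
  have K': "0 \<le> K'" using K \<omega> by (simp add: K'_def)
  have *: "hausdorff_content \<delta> m B \<le> 0 + ennreal e" if \<delta>: "0 < \<delta>" and e: "0 < e" for \<delta> e
  proof -
    define t where "t = e / \<omega>"
    \<comment> \<open>The integral of \<open>F\<close> is to fall strictly below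
      \<open>t * \<Omega>\<close>, the integral of the constant \<open>t\<close> over the unit ball;
      \<open>K' + 1\<close> and the factor 2 secure strictness, also for
      \<open>K' = 0\<close>.\<close>
    define \<eta> where "\<eta> = t * \<Omega> / (K' + 1) / 2"
    have t: "0 < t" "0 < \<eta>" using e \<omega> K' by (simp_all add: t_def \<eta>_def)
    obtain E where E: "E \<in> null_sets lborel" "{u. x + orth_proj V u \<in> B} \<subseteq> E"
      using neg by (auto simp: negligible_iff_null_sets null_sets_completion_iff2)
    then have E': "E \<in> sets borel" "emeasure lborel E = 0" by auto
    obtain U where U: "open U" "E \<subseteq> U" "emeasure lborel U \<le> emeasure lborel E + \<eta>"
      using outer_open_le[OF E'(1) t(2)] by blast
    \<comment> \<open>The covering balls have radius \<open>5 * \<rho> i\<close>, so this bound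
      keeps their diameters at most \<open>\<delta>\<close>.\<close>
    have \<delta>10: "0 < \<delta> / 10" using \<delta> by simp
    obtain a \<rho> where a: "\<And>i. 0 \<le> \<rho> i" "\<And>i. \<rho> i \<le> \<delta> / 10" "E \<subseteq> (\<Union>i. cball (a i) (5 * \<rho> i))"
      "(\<Sum>i. emeasure lborel (cball (a i) (\<rho> i))) \<le> emeasure lborel U"
      by (rule vitali_covering_sequence[OF U(1,2) \<delta>10]) (rule that; simp)
    define s where "s i = 5 * \<rho> i" for i
    have s: "0 \<le> s i" "2 * s i \<le> \<delta>" for i
      using a(1)[of i] a(2)[of i] by (simp_all add: s_def)
    \<comment> \<open>Within the unit ball, \<open>w\<close> lies in \<open>Z i\<close> exactly when
      the translate \<open>V + w\<close> comes within \<open>s i\<close> of the centre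
      \<open>a i\<close>. Hence \<open>F w\<close> adds up \<open>s i ^ m\<close> over the balls
      that this translate meets.\<close>
    define Z where "Z i = {w. norm w \<le> 1 \<and> norm (?Q w - ?Q (a i)) \<le> s i}" for i
    have "closed (Z i)" for i
      unfolding Z_def
      by (intro closed_Collect_conj closed_Collect_le continuous_intros
          linear_continuous_on_compose[OF _ linear_orth_proj])
    then have Z [measurable]: "Z i \<in> sets borel" for i by auto
    define F where "F w = (\<Sum>i. ennreal (s i ^ m) * indicator (Z i) w)" for w
    have Fi: "ennreal (s i ^ m) * emeasure lborel (Z i) \<le> ennreal K' * emeasure lborel (cball (a i) (\<rho> i))" for i
    proof -
      have "ennreal (s i ^ m) * emeasure lborel (Z i)
          \<le> ennreal (s i ^ m) * ennreal (K * s i ^ dim (orthogonal_comp V))"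
        using K(2)[OF s(1)] by (auto simp: Z_def intro!: mult_left_mono)
      also have "\<dots> = ennreal (K * s i ^ ?n)"
        using K s by (simp add: ennreal_mult'[symmetric] dimQ[symmetric] power_add mult_ac)
      also have "K * s i ^ ?n = K' * (\<Omega> * \<rho> i ^ ?n)"
        using \<omega> by (simp add: K'_def s_def power_mult_distrib)
      also have "ennreal \<dots> = ennreal K' * emeasure lborel (cball (a i) (\<rho> i))"
        using K' a(1) \<omega> by (simp add: emeasure_cball \<Omega>_def ennreal_mult')
      finally show ?thesis .
    qed
    have "integral\<^sup>N lborel F = (\<Sum>i. ennreal (s i ^ m) * emeasure lborel (Z i))"
      unfolding F_def by (subst nn_integral_suminf) (simp_all add: nn_integral_cmult_indicator)
    also have "\<dots> \<le> (\<Sum>i. ennreal K' * emeasure lborel (cball (a i) (\<rho> i)))"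
      using Fi by (intro suminf_le) auto
    also have "\<dots> \<le> ennreal K' * ennreal \<eta>"
      using a(4) U(3) E'(2) by (auto simp: ennreal_suminf_cmult intro!: mult_left_mono)
    also have "\<dots> < ennreal (t * \<Omega>)"
    proof -
      have "K' * \<eta> = (K' / (K' + 1)) * (t * \<Omega> / 2)" by (simp add: \<eta>_def)
      also have "\<dots> \<le> 1 * (t * \<Omega> / 2)" using K' t \<omega> by (intro mult_right_mono) auto
      also have "\<dots> < t * \<Omega>" using t \<omega> by simp
      finally show ?thesis using K' t \<omega> by (simp add: ennreal_mult'[symmetric] ennreal_lessI)
    qed
    finally have Fint: "integral\<^sup>N lborel F < ennreal (t * \<Omega>)" .
    have "\<exists>w\<in>cball 0 1. F w < ennreal t"
    proof (rule ccontr)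
      assume "\<not> ?thesis"
      then have *: "ennreal t * indicator (cball 0 1) w \<le> F w" for w
        by (auto simp: indicator_def not_less)
      have "(\<integral>\<^sup>+ w. ennreal t * indicator (cball 0 1 :: 'a set) w \<partial>lborel) \<le> integral\<^sup>N lborel F"
        by (rule nn_integral_mono) (rule *)
      also have "(\<integral>\<^sup>+ w. ennreal t * indicator (cball 0 1 :: 'a set) w \<partial>lborel) = ennreal (t * \<Omega>)"
        using t \<omega> by (simp add: nn_integral_cmult_indicator emeasure_cball \<Omega>_def ennreal_mult')
      finally show False using Fint by simp
    qed
    then obtain w where w: "norm w \<le> 1" "F w < ennreal t" by auto
    define C where "C i = (if w \<in> Z i then cball (x + orth_proj V (a i)) (s i) else {})" for i
    have "B \<subseteq> (\<Union>i. C i)"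
    proof
      fix b assume b: "b \<in> B"
      then obtain v where v: "v \<in> V" "b = x + v" using B by auto
      \<comment> \<open>The point above \<open>b\<close> in the translate \<open>V + w\<close>: it
        projects to \<open>v\<close>, so it belongs to the covered preimage, and its normal part is
        that of \<open>w\<close>.\<close>
      define u where "u = v + ?Q w"
      have Pu: "orth_proj V u = v" using PV[OF v(1)] by (simp add: u_def)
      then have "u \<in> E" using b v E(2) by auto
      then obtain i where i: "u \<in> cball (a i) (s i)" using a(3) by (auto simp: s_def)
      then have ni: "norm (u - a i) \<le> s i" by (simp add: dist_norm norm_minus_commute)
      have "?Q u = ?Q w" using Pu by (simp add: Q u_def)
      then have "w \<in> Z i"
        using order.trans[OF Qlip[of u "a i"] ni] w by (simp add: Z_def)
      moreover have "norm (v - orth_proj V (a i)) \<le> s i"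
        using order.trans[OF Pdist[of u "a i"] ni] by (simp add: Pu)
      then have "b \<in> cball (x + orth_proj V (a i)) (s i)"
        using v by (simp add: dist_norm norm_minus_commute)
      ultimately show "b \<in> (\<Union>i. C i)" by (auto simp: C_def)
    qed
    moreover have dC: "bounded (C i) \<and> diameter (C i) \<le> 2 * s i" for i
    proof -
      have "norm (y - z) \<le> 2 * s i" if "y \<in> cball c (s i)" "z \<in> cball c (s i)" for c y z :: 'a
        using that dist_triangle[of y z c] by (simp add: dist_norm norm_minus_commute)
      then show ?thesis
        using s(1)[of i] by (auto simp: C_def intro!: diameter_le)
    qed
    ultimately have "hausdorff_content \<delta> m B \<le> (\<Sum>i. hausdorff_weight m (C i))"
      unfolding hausdorff_content_def
      using s(2) by (intro INF_lower) (auto intro: order.trans)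
    also have "\<dots> \<le> (\<Sum>i. ennreal \<omega> * (ennreal (s i ^ m) * indicator (Z i) w))"
    proof (intro suminf_le)
      fix i
      show "hausdorff_weight m (C i) \<le> ennreal \<omega> * (ennreal (s i ^ m) * indicator (Z i) w)"
      proof (cases "w \<in> Z i")
        case True
        have "(diameter (C i) / 2) ^ m \<le> s i ^ m"
          using dC[of i] diameter_ge_0[of "C i"] by (intro power_mono) auto
        then have "ennreal (\<omega> * (diameter (C i) / 2) ^ m) \<le> ennreal (\<omega> * s i ^ m)"
          using \<omega> by (intro ennreal_leI mult_left_mono) auto
        then show ?thesis
          using True \<omega> s by (auto simp: hausdorff_weight_def \<omega>_def[symmetric] ennreal_mult')
      qed (simp add: hausdorff_weight_def C_def)
    qed auto
    also have "\<dots> = ennreal \<omega> * F w"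
      by (simp add: F_def ennreal_suminf_cmult)
    also have "\<dots> \<le> ennreal \<omega> * ennreal t"
      using w by (intro mult_left_mono) auto
    also have "\<dots> = ennreal e"
      using \<omega> t by (simp add: t_def ennreal_mult'[symmetric])
    finally show ?thesis by simp
  qed
  have "hausdorff_content \<delta> m B \<le> 0" if "0 < \<delta>" for \<delta>
    by (rule ennreal_le_epsilon) (rule *[OF that])
  then show ?thesis
    unfolding hausdorff_measure_def by (intro antisym SUP_least) auto
qed

subsection \<open>Differentiation of Lipschitz functions on the line\<close>

text \<open>The Vitali covering theorem selects disjoint balls of the fine family that exhaust
  \<open>E\<close> up to a Lebesgue null set, which \<open>M\<close> does not see either; the
  inequality is then summed over these balls inside \<open>U\<close>. Balls need only contain
  \<open>x\<close>, not be centred there, which permits intervals with \<open>x\<close> as an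
  endpoint.\<close>

lemma vitali_measure_comparison:
  fixes M N :: "'a::euclidean_space measure"
  assumes sets: "sets M = sets borel" "sets N = sets borel"
    and ac: "absolutely_continuous lborel M"
    and E: "E \<in> sets borel" and U: "U \<in> sets borel"
    and fine: "\<And>x d. x \<in> E \<Longrightarrow> 0 < d \<Longrightarrow> \<exists>c r. 0 < r \<and> r < d \<and> x \<in> cball c r \<and> cball c r \<subseteq> U \<and>
      emeasure M (cball c r) \<le> emeasure N (cball c r)"
  shows "emeasure M E \<le> emeasure N U"
proof -
  define K where "K = {(c, r). 0 < r \<and> cball c r \<subseteq> U \<and> emeasure M (cball c r) \<le> emeasure N (cball c r)}"
  have K1: "0 < snd i" if "i \<in> K" for i
    using that by (auto simp: K_def)
  have K2: "\<exists>i. i \<in> K \<and> x \<in> cball (fst i) (snd i) \<and> snd i < d" if xd: "x \<in> E" "0 < d" for x d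
  proof -
    obtain c r where "0 < r" "r < d" "x \<in> cball c r" "cball c r \<subseteq> U"
      "emeasure M (cball c r) \<le> emeasure N (cball c r)"
      using fine[OF xd] by blast
    then show ?thesis by (intro exI[of _ "(c, r)"]) (auto simp: K_def)
  qed
  obtain C where C: "countable C" "C \<subseteq> K"
    "pairwise (\<lambda>i j. disjnt (cball (fst i) (snd i)) (cball (fst j) (snd j))) C"
    "negligible (E - (\<Union>i\<in>C. cball (fst i) (snd i)))"
    by (rule Vitali_covering_theorem_cballs[OF K1 K2])
  let ?B = "\<lambda>i. cball (fst i) (snd i)"
  have UC: "(\<Union>i\<in>C. ?B i) \<in> sets borel"
    using C(1) by (intro sets.countable_UN') auto
  have dis: "disjoint_family_on ?B C"
    using C(3) by (auto simp: disjoint_family_on_def pairwise_def disjnt_def)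
  have "E - (\<Union>i\<in>C. ?B i) \<in> null_sets lborel"
    using C(4) E UC by (auto simp: negligible_iff_null_sets null_sets_completion_iff)
  then have null: "E - (\<Union>i\<in>C. ?B i) \<in> null_sets M"
    using ac by (auto simp: absolutely_continuous_def)
  have "emeasure M E \<le> emeasure M ((\<Union>i\<in>C. ?B i) \<union> (E - (\<Union>i\<in>C. ?B i)))"
    using E UC by (intro emeasure_mono) (auto simp: sets)
  also have "\<dots> = emeasure M (\<Union>i\<in>C. ?B i)"
    using UC null by (intro emeasure_Un_null_set) (auto simp: sets)
  also have "\<dots> = (\<integral>\<^sup>+i. emeasure M (?B i) \<partial>count_space C)"
    using C(1) dis by (intro emeasure_UN_countable) (auto simp: sets)
  also have "\<dots> \<le> (\<integral>\<^sup>+i. emeasure N (?B i) \<partial>count_space C)"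
    using C(2) by (intro nn_integral_mono) (auto simp: K_def)
  also have "\<dots> = emeasure N (\<Union>i\<in>C. ?B i)"
    using C(1) dis by (intro emeasure_UN_countable[symmetric]) (auto simp: sets)
  also have "\<dots> \<le> emeasure N U"
  proof (intro emeasure_mono UN_least)
    show "?B i \<subseteq> U" if "i \<in> C" for i
      using subsetD[OF C(2) that] by (simp add: K_def case_prod_beta)
  qed (use U sets in auto)
  finally show ?thesis .
qed

text \<open>Supplies absolute continuity of the Stieltjes measure and controls its mass on a small
  excess set. The 5 is the Vitali enlargement.\<close>

lemma emeasure_interval_measure_lipschitz_le:
  fixes F :: "real \<Rightarrow> real"
  assumes mono: "\<And>x y. x \<le> y \<Longrightarrow> F x \<le> F y" and L: "L-lipschitz_on UNIV F" and A: "A \<in> sets borel"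
  shows "emeasure (interval_measure F) A \<le> ennreal (5 * L) * emeasure lborel A"
proof (rule ennreal_le_epsilon)
  fix e :: real assume e: "0 < e"
  have L0: "0 \<le> L" using L lipschitz_on_nonneg by blast
  have cont: "continuous_on UNIV F" using L lipschitz_on_continuous_on by blast
  have e': "0 < e / (5 * L + 1)" using e L0 by simp
  obtain U where U: "open U" "A \<subseteq> U" "emeasure lborel U \<le> emeasure lborel A + ennreal (e / (5 * L + 1))"
    using outer_open_le[OF A e'] by blast
  obtain a \<rho> where a: "\<And>i. 0 \<le> \<rho> i" "\<And>i. \<rho> i \<le> 1" "A \<subseteq> (\<Union>i. cball (a i) (5 * \<rho> i))"
    "(\<Sum>i. emeasure lborel (cball (a i) (\<rho> i))) \<le> emeasure lborel U"
    by (rule vitali_covering_sequence[OF U(1,2) zero_less_one]) (rule that; simp)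
  have "emeasure (interval_measure F) (cball (a i) (5 * \<rho> i)) \<le> ennreal (5 * L) * emeasure lborel (cball (a i) (\<rho> i))" for i
  proof -
    have "emeasure (interval_measure F) (cball (a i) (5 * \<rho> i)) = ennreal (F (a i + 5 * \<rho> i) - F (a i - 5 * \<rho> i))"
      using a(1)[of i] by (simp add: cball_eq_atLeastAtMost emeasure_interval_measure_Icc[OF _ mono cont])
    also have "F (a i + 5 * \<rho> i) - F (a i - 5 * \<rho> i) \<le> L * (10 * \<rho> i)"
      using lipschitz_onD[OF L, of "a i + 5 * \<rho> i" "a i - 5 * \<rho> i"] a(1)[of i] by (simp add: dist_real_def)
    also have "ennreal (L * (10 * \<rho> i)) = ennreal (5 * L) * emeasure lborel (cball (a i) (\<rho> i))"
      using a(1)[of i] L0 by (simp add: cball_eq_atLeastAtMost ennreal_mult'[symmetric])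
    finally show ?thesis by (simp add: ennreal_leI)
  qed
  note ball = this
  have "emeasure (interval_measure F) A \<le> emeasure (interval_measure F) (\<Union>i. cball (a i) (5 * \<rho> i))"
    using a(3) by (intro emeasure_mono) auto
  also have "\<dots> \<le> (\<Sum>i. emeasure (interval_measure F) (cball (a i) (5 * \<rho> i)))"
    by (rule emeasure_subadditive_countably) auto
  also have "\<dots> \<le> (\<Sum>i. ennreal (5 * L) * emeasure lborel (cball (a i) (\<rho> i)))"
    using ball by (intro suminf_le) auto
  also have "\<dots> \<le> ennreal (5 * L) * (emeasure lborel A + ennreal (e / (5 * L + 1)))"
    unfolding ennreal_suminf_cmult using a(4) U(3) by (intro mult_left_mono) auto
  also have "\<dots> = ennreal (5 * L) * emeasure lborel A + ennreal (5 * L * (e / (5 * L + 1)))"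
    using L0 e by (simp add: distrib_left ennreal_mult'[symmetric])
  also have "\<dots> \<le> ennreal (5 * L) * emeasure lborel A + ennreal e"
    using L0 e by (intro add_left_mono ennreal_leI) (simp add: field_simps)
  finally show "emeasure (interval_measure F) A \<le> ennreal (5 * L) * emeasure lborel A + ennreal e" .
qed

text \<open>For \<open>p < q\<close> the derivative in direction \<open>v\<close> cannot exist at
  such points. Strict inequalities and the countable family of radii make this a countable
  intersection of open sets for continuous \<open>f\<close>, although the union over
  \<open>h\<close> is uncountable.\<close>

definition osc_set :: "real \<Rightarrow> real \<Rightarrow> 'a::real_normed_vector \<Rightarrow> ('a \<Rightarrow> real) \<Rightarrow> 'a set" where
  "osc_set p q v f = {x. (\<forall>n::nat. \<exists>h. h \<noteq> 0 \<and> \<bar>h\<bar> < inverse (Suc n) \<and> (f (x + h *\<^sub>R v) - f x) / h < p) \<and>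
    (\<forall>n::nat. \<exists>h. h \<noteq> 0 \<and> \<bar>h\<bar> < inverse (Suc n) \<and> q < (f (x + h *\<^sub>R v) - f x) / h)}"

lemma borel_osc_set:
  fixes f :: "'a::real_normed_vector \<Rightarrow> real"
  assumes "continuous_on UNIV f"
  shows "osc_set p q v f \<in> sets borel"
proof -
  have eq: "osc_set p q v f =
      (\<Inter>n. \<Union>h\<in>{h. h \<noteq> 0 \<and> \<bar>h\<bar> < inverse (Suc n)}. {x. (f (x + h *\<^sub>R v) - f x) / h < p}) \<inter>
      (\<Inter>n. \<Union>h\<in>{h. h \<noteq> 0 \<and> \<bar>h\<bar> < inverse (Suc n)}. {x. q < (f (x + h *\<^sub>R v) - f x) / h})"
    unfolding osc_set_def by auto
  have cont: "continuous_on UNIV (\<lambda>x. (f (x + h *\<^sub>R v) - f x) / h)" if "h \<noteq> 0" for h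
    using that assms by (auto intro!: continuous_intros intro: continuous_on_compose2[OF assms])
  have "open (\<Union>h\<in>{h. h \<noteq> 0 \<and> \<bar>h\<bar> < inverse (real (Suc n))}. {x. (f (x + h *\<^sub>R v) - f x) / h < p})"
    "open (\<Union>h\<in>{h. h \<noteq> 0 \<and> \<bar>h\<bar> < inverse (real (Suc n))}. {x. q < (f (x + h *\<^sub>R v) - f x) / h})" for n
    by (auto intro!: open_UN open_Collect_less cont)
  then show ?thesis
    unfolding eq by (intro sets.Int sets.countable_INT) auto
qed

text \<open>After adding \<open>L * x\<close> the function is monotone and defines a Stieltjes
  measure \<open>M\<close>. Each point of the set lies in arbitrarily short intervals with
  \<open>M\<close> at most \<open>P\<close> times the length, and in others with \<open>M\<close> at
  least \<open>Q\<close> times the length. Comparing measures in an open \<open>U\<close> shrinking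
  to the set gives \<open>Q * m \<le> P * m\<close> for the measure \<open>m\<close> of a bounded
  piece, hence \<open>m = 0\<close>.\<close>

lemma null_osc_set_real:
  fixes f :: "real \<Rightarrow> real"
  assumes L: "L-lipschitz_on UNIV f" and pq: "p < q"
  shows "osc_set p q 1 f \<in> null_sets lborel"
proof -
  have L0: "0 \<le> L" using L lipschitz_on_nonneg by blast
  have contf: "continuous_on UNIV f" using L lipschitz_on_continuous_on by blast
  define F where "F x = f x + L * x" for x
  have fL: "\<bar>f y - f x\<bar> \<le> L * \<bar>y - x\<bar>" for x y
    using lipschitz_onD[OF L, of y x] by (simp add: dist_real_def)
  have mono: "F x \<le> F y" if "x \<le> y" for x y
    using fL[of y x] that by (simp add: F_def algebra_simps abs_le_iff)
  have FL: "(2 * L)-lipschitz_on UNIV F"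
  proof (rule lipschitz_onI)
    fix x y
    have "\<bar>F x - F y\<bar> \<le> \<bar>f x - f y\<bar> + \<bar>L * (x - y)\<bar>"
      by (simp add: F_def algebra_simps)
    then show "dist (F x) (F y) \<le> 2 * L * dist x y"
      using fL[of x y] L0 by (simp add: dist_real_def abs_mult)
  qed (use L0 in simp)
  have cont: "continuous_on UNIV F" using FL lipschitz_on_continuous_on by blast
  define M where "M = interval_measure F"
  have sM [simp]: "sets M = sets borel" by (simp add: M_def)
  have Mle: "emeasure M A \<le> ennreal (10 * L) * emeasure lborel A" if "A \<in> sets borel" for A
    using emeasure_interval_measure_lipschitz_le[OF mono FL that] by (simp add: M_def)
  have Mcball: "emeasure M (cball c r) = ennreal (F (c + r) - F (c - r))" if "0 \<le> r" for c r
    using that by (simp add: M_def cball_eq_atLeastAtMost emeasure_interval_measure_Icc[OF _ mono cont])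
  have lcball: "emeasure lborel (cball c r) = ennreal (2 * r)" if "0 \<le> r" for c r :: real
    using that by (simp add: cball_eq_atLeastAtMost)
  have ac: "absolutely_continuous lborel M"
    unfolding absolutely_continuous_def
  proof
    fix A :: "real set" assume "A \<in> null_sets lborel"
    then show "A \<in> null_sets M" using Mle[of A] by (auto simp: null_sets_def)
  qed
  define P Q where "P = p + L" and "Q = q + L"
  have main: "osc_set p q 1 f \<inter> {-real k<..<real k} \<in> null_sets lborel" (is "?E \<in> _") for k :: nat
  proof (cases "?E = {}")
    case False
    have E: "?E \<in> sets borel" using borel_osc_set[OF contf] by auto
    \<comment> \<open>Difference quotients of \<open>f\<close> are at least \<open>- L\<close>, so a
      nonempty set forces \<open>- L < p\<close>. The sign matters because \<open>ennreal\<close>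
      truncates negative numbers to 0.\<close>
    have P0: "0 \<le> P"
    proof -
      from False obtain x where "x \<in> osc_set p q 1 f" by auto
      then obtain h where "h \<noteq> 0" "(f (x + h) - f x) / h < p"
        unfolding osc_set_def by auto
      moreover then have "- L \<le> (f (x + h) - f x) / h"
        using fL[of "x + h" x] by (cases "h > 0") (auto simp: field_simps abs_le_iff)
      ultimately show ?thesis by (simp add: P_def)
    qed
    have "emeasure lborel ?E \<le> emeasure lborel (cball (0 :: real) (real k))"
      by (intro emeasure_mono) (auto simp: cball_eq_atLeastAtMost)
    then have fin: "emeasure lborel ?E < \<infinity>"
      by (rule order.strict_trans1) (simp add: cball_eq_atLeastAtMost)
    define m where "m = measure lborel ?E"
    have m: "emeasure lborel ?E = ennreal m" "0 \<le> m"
      using fin by (auto simp: m_def emeasure_eq_ennreal_measure)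
    \<comment> \<open>\<open>P * e\<close> arises from measuring \<open>U\<close> instead of the
      set, \<open>10 * L * e\<close> from the \<open>M\<close>-measure of the excess, where
      \<open>10 * L\<close> is 5 times the Lipschitz constant \<open>2 * L\<close> of
      \<open>F\<close>.\<close>
    have step: "Q * m \<le> P * m + (P + 10 * L) * e" if e: "0 < e" for e
    proof -
      obtain U where U: "open U" "?E \<subseteq> U" "emeasure lborel (U - ?E) \<le> ennreal e"
        using outer_regular_lborel_le[OF E e] by blast
      have U': "U \<in> sets borel" using U by auto
      have Usum: "emeasure N U \<le> emeasure N ?E + emeasure N (U - ?E)" if "sets N = sets borel" for N
      proof -
        have "emeasure N (?E \<union> (U - ?E)) \<le> emeasure N ?E + emeasure N (U - ?E)"
          using E U' that by (intro emeasure_subadditive) auto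
        then show ?thesis using U(2) by (simp add: Un_absorb1)
      qed
      \<comment> \<open>The interval between \<open>x\<close> and \<open>x + h\<close> is a closed
        ball about its midpoint. \<open>R\<close> stands for either growth inequality, applied to
        the endpoints in increasing order, so that both comparisons share this construction.\<close>
      have fine: "\<exists>c r. 0 < r \<and> r < d \<and> x \<in> cball c r \<and> cball c r \<subseteq> U \<and> R (c - r) (c + r)"
        if x: "x \<in> ?E" and d: "0 < d" and
          R: "\<And>n::nat. \<exists>h. h \<noteq> 0 \<and> \<bar>h\<bar> < inverse (Suc n) \<and> (if h > 0 then R x (x + h) else R (x + h) x)" for x d R
      proof -
        obtain e where e: "e > 0" "cball x e \<subseteq> U"
          using U x open_contains_cball by blast
        obtain n :: nat where n: "inverse (Suc n) < min d e"
          using reals_Archimedean[of "min d e"] d e by auto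
        obtain h where h: "h \<noteq> 0" "\<bar>h\<bar> < inverse (Suc n)" "if h > 0 then R x (x + h) else R (x + h) x"
          using R[of n] by blast
        define c r where "c = x + h / 2" and "r = \<bar>h\<bar> / 2"
        have "0 < r" "r < d" "x \<in> cball c r" using h n by (auto simp: c_def r_def dist_real_def)
        moreover have "cball c r \<subseteq> cball x e"
        proof
          fix y assume "y \<in> cball c r"
          then have "\<bar>x + h / 2 - y\<bar> \<le> \<bar>h\<bar> / 2" by (simp add: c_def r_def dist_real_def)
          then have "\<bar>x - y\<bar> \<le> \<bar>h\<bar>" by linarith
          then show "y \<in> cball x e" using h n by (simp add: dist_real_def)
        qed
        moreover have "R (c - r) (c + r)"
          using h by (auto simp: c_def r_def add.commute[of h x] split: if_splits)
        ultimately show ?thesis using e by blast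
      qed
      have "emeasure M ?E \<le> emeasure (scale_measure (ennreal P) lborel) U"
      proof (rule vitali_measure_comparison)
        fix x d :: real assume x: "x \<in> ?E" and d: "0 < d"
        have "\<exists>h. h \<noteq> 0 \<and> \<bar>h\<bar> < inverse (Suc n) \<and>
            (if h > 0 then F (x + h) - F x \<le> P * (x + h - x) else F x - F (x + h) \<le> P * (x - (x + h)))" for n :: nat
        proof -
          obtain h where h: "h \<noteq> 0" "\<bar>h\<bar> < inverse (Suc n)" "(f (x + h) - f x) / h < p"
            using x by (auto simp: osc_set_def)
          then show ?thesis
            by (intro exI[of _ h]) (auto simp: F_def P_def field_simps split: if_splits)
        qed
        from fine[OF x d, of "\<lambda>a b. F b - F a \<le> P * (b - a)", OF this] obtain c r where cr: "0 < r" "r < d" "x \<in> cball c r" "cball c r \<subseteq> U"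
          "F (c + r) - F (c - r) \<le> P * (c + r - (c - r))" by blast
        moreover have "emeasure M (cball c r) \<le> emeasure (scale_measure (ennreal P) lborel) (cball c r)"
          using cr P0 by (simp add: Mcball lcball ennreal_mult'[symmetric] ennreal_leI)
        ultimately show "\<exists>c r. 0 < r \<and> r < d \<and> x \<in> cball c r \<and> cball c r \<subseteq> U \<and>
          emeasure M (cball c r) \<le> emeasure (scale_measure (ennreal P) lborel) (cball c r)" by blast
      qed (use E U' ac in auto)
      moreover have "emeasure (scale_measure (ennreal Q) lborel) ?E \<le> emeasure M U"
      proof (rule vitali_measure_comparison)
        fix x d :: real assume x: "x \<in> ?E" and d: "0 < d"
        have "\<exists>h. h \<noteq> 0 \<and> \<bar>h\<bar> < inverse (Suc n) \<and>
            (if h > 0 then F (x + h) - F x \<ge> Q * (x + h - x) else F x - F (x + h) \<ge> Q * (x - (x + h)))" for n :: nat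
        proof -
          obtain h where h: "h \<noteq> 0" "\<bar>h\<bar> < inverse (Suc n)" "q < (f (x + h) - f x) / h"
            using x by (auto simp: osc_set_def)
          then show ?thesis
            by (intro exI[of _ h]) (auto simp: F_def Q_def field_simps split: if_splits)
        qed
        from fine[OF x d, of "\<lambda>a b. F b - F a \<ge> Q * (b - a)", OF this] obtain c r where cr: "0 < r" "r < d" "x \<in> cball c r" "cball c r \<subseteq> U"
          "F (c + r) - F (c - r) \<ge> Q * (c + r - (c - r))" by blast
        moreover have "emeasure (scale_measure (ennreal Q) lborel) (cball c r) \<le> emeasure M (cball c r)"
          using cr P0 pq by (simp add: Mcball lcball P_def Q_def ennreal_mult'[symmetric] ennreal_leI)
        ultimately show "\<exists>c r. 0 < r \<and> r < d \<and> x \<in> cball c r \<and> cball c r \<subseteq> U \<and>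
          emeasure (scale_measure (ennreal Q) lborel) (cball c r) \<le> emeasure M (cball c r)" by blast
      qed (use E U' in \<open>auto simp: absolutely_continuous_def null_sets_def\<close>)
      ultimately have 1: "emeasure M ?E \<le> ennreal P * emeasure lborel U" "ennreal Q * ennreal m \<le> emeasure M U"
        by (simp_all add: m)
      have "ennreal Q * ennreal m \<le> emeasure M ?E + emeasure M (U - ?E)"
        using 1(2) Usum[of M] by auto
      also have "\<dots> \<le> ennreal P * emeasure lborel U + ennreal (10 * L) * emeasure lborel (U - ?E)"
        using 1(1) Mle[of "U - ?E"] E U' by (intro add_mono) auto
      also have "\<dots> \<le> ennreal P * (ennreal m + ennreal e) + ennreal (10 * L) * ennreal e"
        using Usum[of lborel] U(3) m(1)
        by (intro add_mono mult_left_mono) (auto intro: order.trans[OF _ add_left_mono])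
      also have "\<dots> = ennreal (P * (m + e) + 10 * L * e)"
        using P0 m L0 e by (simp add: ennreal_mult'[symmetric] ennreal_plus[symmetric] del: ennreal_plus)
      finally have "ennreal (Q * m) \<le> ennreal (P * (m + e) + 10 * L * e)"
        using P0 pq m by (simp add: P_def Q_def ennreal_mult'[symmetric])
      then show ?thesis
        using P0 m L0 e by (subst (asm) ennreal_le_iff) (auto simp: algebra_simps)
    qed
    have "Q * m \<le> P * m"
    proof (rule field_le_epsilon)
      fix e :: real assume e: "0 < e"
      have "(P + 10 * L) * (e / (P + 10 * L + 1)) \<le> e"
        using P0 L0 e by (simp add: field_simps)
      then show "Q * m \<le> P * m + e"
        using step[of "e / (P + 10 * L + 1)"] P0 L0 e by (auto simp: add_pos_nonneg)
    qed
    then have "(Q - P) * m \<le> 0" by (simp add: algebra_simps)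
    then have "m \<le> 0" using pq by (simp add: P_def Q_def mult_le_0_iff)
    then show ?thesis using m E by (auto simp: null_sets_def)
  qed auto
  have "(\<Union>k::nat. osc_set p q 1 f \<inter> {-real k<..<real k}) \<in> null_sets lborel"
    using main by blast
  moreover have "(\<Union>k::nat. osc_set p q 1 f \<inter> {-real k<..<real k}) = osc_set p q 1 f"
  proof -
    have "\<exists>k::nat. - real k < x \<and> x < real k" for x :: real
    proof -
      obtain k :: nat where "\<bar>x\<bar> < real k" using reals_Archimedean2 by blast
      then show ?thesis by (intro exI[of _ k]) linarith
    qed
    then show ?thesis by auto
  qed
  ultimately show ?thesis by simp
qed

subsection \<open>Rademacher's theorem\<close>

lemma AE_lborel_commute:
  fixes P :: "'a::euclidean_space \<Rightarrow> 'b::euclidean_space \<Rightarrow> bool"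
  assumes "{z. P (fst z) (snd z)} \<in> sets borel"
  shows "(AE x in lborel. AE y in lborel. P x y) \<longleftrightarrow> (AE y in lborel. AE x in lborel. P x y)"
  by (rule lborel_pair.AE_commute) (unfold lborel_prod, use assms in simp)

lemma AE_lborel_witness:
  fixes P :: "'a::euclidean_space \<Rightarrow> bool"
  assumes "AE x in lborel. P x" "open U" "U \<noteq> {}"
  shows "\<exists>x\<in>U. P x"
proof (rule ccontr)
  assume *: "\<not> ?thesis"
  have "AE x in lborel. x \<notin> U"
    using assms(1) by eventually_elim (use * in auto)
  then have "U \<in> null_sets lborel"
    using AE_iff_null_sets[of U lborel] assms(2) by auto
  then have "negligible U"
    by (simp add: negligible_iff_null_sets null_sets_completionI)
  then show False
    using open_not_negligible assms by blast
qed

text \<open>No coordinates along \<open>v\<close> are chosen: Fubini over pairs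
  \<open>(x, t)\<close> yields a single \<open>t\<close> for which \<open>x + t *\<^sub>R v\<close>
  avoids \<open>A\<close> for almost every \<open>x\<close>, and translation invariance does the
  rest.\<close>

lemma null_sets_lborel_lines:
  fixes A :: "'a::euclidean_space set"
  assumes A: "A \<in> sets borel" and lines: "\<And>x. {t. x + t *\<^sub>R v \<in> A} \<in> null_sets lborel"
  shows "A \<in> null_sets lborel"
proof -
  have "AE x in lborel. AE t in lborel. x + t *\<^sub>R v \<notin> A"
    using AE_not_in[OF lines] by simp
  moreover have "{z::'a \<times> real. fst z + snd z *\<^sub>R v \<notin> A} \<in> sets borel"
  proof -
    have "(\<lambda>z::'a \<times> real. fst z + snd z *\<^sub>R v) -` (- A) \<inter> space borel \<in> sets borel"
      by (rule measurable_sets[OF borel_measurable_continuous_onI]) (use A in \<open>auto intro!: continuous_intros\<close>)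
    then show ?thesis by (simp add: vimage_def)
  qed
  ultimately have "AE t::real in lborel. AE x in lborel. x + t *\<^sub>R v \<notin> A"
    by (subst (asm) AE_lborel_commute) auto
  then obtain t :: real where t: "AE x in lborel. x + t *\<^sub>R v \<notin> A"
    using AE_lborel_witness[of _ UNIV] by blast
  have "AE x in distr lborel borel ((+) (t *\<^sub>R v)). x \<notin> A"
    using A t by (subst AE_distr_iff) (auto simp: add.commute)
  then have "AE x in lborel. x \<notin> A"
    unfolding lborel_distr_plus .
  then show ?thesis
    using AE_iff_null_sets[of A lborel] A by simp
qed

lemma null_osc_set:
  fixes f :: "'a::euclidean_space \<Rightarrow> real"
  assumes L: "L-lipschitz_on UNIV f" and pq: "p < q"
  shows "osc_set p q v f \<in> null_sets lborel"
proof (rule null_sets_lborel_lines)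
  show "osc_set p q v f \<in> sets borel"
    using L lipschitz_on_continuous_on by (intro borel_osc_set) blast
  fix x
  have "(L * norm v)-lipschitz_on UNIV (\<lambda>t. f (x + t *\<^sub>R v))"
  proof (rule lipschitz_onI)
    fix s t
    have "dist (f (x + s *\<^sub>R v)) (f (x + t *\<^sub>R v)) \<le> L * dist (x + s *\<^sub>R v) (x + t *\<^sub>R v)"
      using L by (rule lipschitz_onD) auto
    also have "dist (x + s *\<^sub>R v) (x + t *\<^sub>R v) = norm v * dist s t"
      by (simp add: dist_norm flip: scaleR_diff_left)
    finally show "dist (f (x + s *\<^sub>R v)) (f (x + t *\<^sub>R v)) \<le> L * norm v * dist s t"
      by (simp add: mult.assoc)
  qed (use lipschitz_on_nonneg[OF L] in simp)
  then have "osc_set p q 1 (\<lambda>t. f (x + t *\<^sub>R v)) \<in> null_sets lborel"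
    using pq by (rule null_osc_set_real)
  moreover have "osc_set p q 1 (\<lambda>t. f (x + t *\<^sub>R v)) = {t. x + t *\<^sub>R v \<in> osc_set p q v f}"
    unfolding osc_set_def by (simp add: scaleR_add_left add.assoc)
  ultimately show "{t. x + t *\<^sub>R v \<in> osc_set p q v f} \<in> null_sets lborel" by simp
qed

lemma lipschitz_quotient_bound:
  fixes f :: "'a::euclidean_space \<Rightarrow> real"
  assumes L: "L-lipschitz_on UNIV f"
  shows "\<bar>(f (x + h *\<^sub>R v) - f x) / h\<bar> \<le> L * norm v"
proof (cases "h = 0")
  case False
  have "\<bar>f (x + h *\<^sub>R v) - f x\<bar> \<le> L * (\<bar>h\<bar> * norm v)"
    using lipschitz_onD[OF L, of "x + h *\<^sub>R v" x] by (simp add: dist_norm)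
  then show ?thesis using False by (simp add: field_simps)
qed (use lipschitz_on_nonneg[OF L] in simp)

text \<open>Boundedness keeps the lower and upper limits finite; if they differed, two rationals
  strictly between them would contradict \<open>osc\<close>. Rational thresholds leave only
  countably many exceptional sets to discard.\<close>

lemma tendsto_of_not_osc:
  fixes \<phi> :: "real \<Rightarrow> real"
  assumes bound: "\<And>h. \<bar>\<phi> h\<bar> \<le> C"
    and osc: "\<And>p q. p \<in> \<rat> \<Longrightarrow> q \<in> \<rat> \<Longrightarrow> p < q \<Longrightarrow>
      (\<forall>\<^sub>F h in at 0. p \<le> \<phi> h) \<or> (\<forall>\<^sub>F h in at 0. \<phi> h \<le> q)"
  shows "\<exists>d. (\<phi> \<longlongrightarrow> d) (at 0)"
proof -
  let ?F = "at (0::real)"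
  define l u where "l = Liminf ?F (\<lambda>h. ereal (\<phi> h))" and "u = Limsup ?F (\<lambda>h. ereal (\<phi> h))"
  have lu: "l \<le> u" unfolding l_def u_def by (rule Liminf_le_Limsup) simp
  have b: "- C \<le> \<phi> h" "\<phi> h \<le> C" for h
    using bound[of h] by (auto simp: abs_le_iff)
  have "ereal (- C) \<le> l"
    unfolding l_def by (rule Liminf_bounded) (use b(1) in simp)
  have "u \<le> ereal C"
    unfolding u_def by (rule Limsup_bounded) (use b(2) in simp)
  have "\<not> l < u"
  proof
    assume "l < u"
    then obtain r1 where r1: "l < ereal r1" "ereal r1 < u" using ereal_dense2 by blast
    then obtain r2 where r2: "ereal r1 < ereal r2" "ereal r2 < u" using ereal_dense2 by blast
    obtain p where p: "p \<in> \<rat>" "r1 < p" "p < r2" using r2 Rats_dense_in_real by auto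
    obtain q where q: "q \<in> \<rat>" "p < q" "q < r2" using p Rats_dense_in_real by blast
    consider "\<forall>\<^sub>F h in at 0. p \<le> \<phi> h" | "\<forall>\<^sub>F h in at 0. \<phi> h \<le> q"
      using osc p q by blast
    then show False
    proof cases
      case 1
      then have "ereal p \<le> l" unfolding l_def by (intro Liminf_bounded) simp
      moreover have "l < ereal p" using order.strict_trans[OF r1(1), of "ereal p"] p(2) by simp
      ultimately show False by simp
    next
      case 2
      then have "u \<le> ereal q" unfolding u_def by (intro Limsup_bounded) simp
      moreover have "ereal q < u" using order.strict_trans[OF _ r2(2), of "ereal q"] q(3) by simp
      ultimately show False by simp
    qed
  qed
  with lu have eq: "l = u" by simp
  then obtain d where d: "l = ereal d"
    using \<open>ereal (- C) \<le> l\<close> \<open>u \<le> ereal C\<close> by (cases l) auto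
  have "((\<lambda>h. ereal (\<phi> h)) \<longlongrightarrow> ereal d) ?F"
    using eq d by (intro Liminf_eq_Limsup) (auto simp: l_def u_def)
  then show ?thesis by auto
qed

lemma AE_directional_derivative:
  fixes f :: "'a::euclidean_space \<Rightarrow> real"
  assumes L: "L-lipschitz_on UNIV f"
  shows "AE x in lborel. \<exists>d. ((\<lambda>h. (f (x + h *\<^sub>R v) - f x) / h) \<longlongrightarrow> d) (at 0)"
proof -
  define Z where "Z = (\<Union>(p, q)\<in>{(p, q). p \<in> \<rat> \<and> q \<in> \<rat> \<and> p < q}. osc_set p q v f)"
  have "countable {(p, q). p \<in> \<rat> \<and> q \<in> \<rat> \<and> p < (q::real)}"
    by (rule countable_subset[of _ "\<rat> \<times> \<rat>"]) (auto intro: countable_rat)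
  then have "Z \<in> null_sets lborel"
    unfolding Z_def using null_osc_set[OF L] by (intro null_sets_UN') auto
  then have "AE x in lborel. x \<notin> Z" by (rule AE_not_in)
  then show ?thesis
  proof eventually_elim
    case (elim x)
    show ?case
    proof (rule tendsto_of_not_osc[where C = "L * norm v"])
      fix p q :: real assume pq: "p \<in> \<rat>" "q \<in> \<rat>" "p < q"
      have ev: "\<forall>\<^sub>F h in at 0. P h" if n: "\<And>h. h \<noteq> 0 \<Longrightarrow> \<bar>h\<bar> < inverse (real (Suc n)) \<Longrightarrow> P h" for n P
        unfolding eventually_at by (rule exI[of _ "inverse (real (Suc n))"]) (use n in auto)
      from elim pq have "x \<notin> osc_set p q v f" by (auto simp: Z_def)
      then consider "\<exists>n. \<forall>h. h \<noteq> 0 \<and> \<bar>h\<bar> < inverse (real (Suc n)) \<longrightarrow> p \<le> (f (x + h *\<^sub>R v) - f x) / h"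
        | "\<exists>n. \<forall>h. h \<noteq> 0 \<and> \<bar>h\<bar> < inverse (real (Suc n)) \<longrightarrow> (f (x + h *\<^sub>R v) - f x) / h \<le> q"
        by (simp only: osc_set_def mem_Collect_eq not_less[symmetric]) blast
      then show "(\<forall>\<^sub>F h in at 0. p \<le> (f (x + h *\<^sub>R v) - f x) / h) \<or>
          (\<forall>\<^sub>F h in at 0. (f (x + h *\<^sub>R v) - f x) / h \<le> q)"
      proof cases
        case 1
        then obtain n where "\<forall>h. h \<noteq> 0 \<and> \<bar>h\<bar> < inverse (real (Suc n)) \<longrightarrow> p \<le> (f (x + h *\<^sub>R v) - f x) / h" ..
        then show ?thesis by (intro disjI1 ev[of n]) auto
      next
        case 2
        then obtain n where "\<forall>h. h \<noteq> 0 \<and> \<bar>h\<bar> < inverse (real (Suc n)) \<longrightarrow> (f (x + h *\<^sub>R v) - f x) / h \<le> q" ..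
        then show ?thesis by (intro disjI2 ev[of n]) auto
      qed
    qed (rule lipschitz_quotient_bound[OF L])
  qed
qed

text \<open>\<open>1 + g / (C + 1)\<close> is an almost everywhere nonnegative density that gives
  every box its Lebesgue measure. Boxes determine Lebesgue measure and densities are unique almost
  everywhere, so this density is 1.\<close>

lemma AE_zero_of_box_integrals:
  fixes g :: "'a::euclidean_space \<Rightarrow> real"
  assumes g [measurable]: "g \<in> borel_measurable borel" and bound: "AE x in lborel. \<bar>g x\<bar> \<le> C" and C: "0 \<le> C"
    and int: "\<And>l u. (\<integral>x. indicator (box l u) x * g x \<partial>lborel) = 0"
  shows "AE x in lborel. g x = 0"
proof -
  define \<phi> where "\<phi> x = 1 + g x / (C + 1)" for x
  have [measurable]: "\<phi> \<in> borel_measurable borel" unfolding \<phi>_def by measurable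
  have pos: "AE x in lborel. 0 \<le> \<phi> x \<and> \<phi> x \<le> 2"
    using bound
  proof eventually_elim
    case (elim x)
    then have "- (C + 1) \<le> g x" "g x \<le> C + 1" by (auto simp: abs_le_iff)
    then show ?case using C by (auto simp: \<phi>_def field_simps)
  qed
  have "lborel = density lborel \<phi>"
  proof (rule lborel_eqI)
    fix l u :: 'a assume lu: "\<And>b. b \<in> Basis \<Longrightarrow> l \<bullet> b \<le> u \<bullet> b"
    have fin: "emeasure lborel (box l u) < \<infinity>" by (simp add: emeasure_lborel_box_eq)
    have i1: "integrable lborel (\<lambda>x. indicator (box l u) x :: real)"
      using fin by (intro integrable_real_indicator) auto
    have i2: "integrable lborel (\<lambda>x. indicator (box l u) x * g x)"
    proof (rule Bochner_Integration.integrable_bound[where f = "\<lambda>x. C * indicator (box l u) x"])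
      show "AE x in lborel. norm (indicator (box l u) x * g x) \<le> norm (C * indicator (box l u) x :: real)"
        using bound by eventually_elim (use C in \<open>auto simp: indicator_def\<close>)
    qed (use i1 in auto)
    have "emeasure (density lborel \<phi>) (box l u) = (\<integral>\<^sup>+x. ennreal (\<phi> x) * indicator (box l u) x \<partial>lborel)"
      by (subst emeasure_density) auto
    also have "\<dots> = (\<integral>\<^sup>+x. ennreal (indicator (box l u) x * \<phi> x) \<partial>lborel)"
      by (intro nn_integral_cong) (auto simp: indicator_def)
    also have "\<dots> = ennreal (\<integral>x. indicator (box l u) x * \<phi> x \<partial>lborel)"
    proof (rule nn_integral_eq_integral)
      have "integrable lborel (\<lambda>x. indicator (box l u) x + (indicator (box l u) x * g x) / (C + 1))"
        using i1 i2 by auto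
      then show "integrable lborel (\<lambda>x. indicator (box l u) x * \<phi> x)"
        by (simp add: \<phi>_def distrib_left)
      show "AE x in lborel. 0 \<le> indicator (box l u) x * \<phi> x"
        using pos by eventually_elim auto
    qed
    also have "(\<integral>x. indicator (box l u) x * \<phi> x \<partial>lborel) =
        (\<integral>x. indicator (box l u) x + (indicator (box l u) x * g x) / (C + 1) \<partial>lborel)"
      by (simp add: \<phi>_def distrib_left)
    also have "\<dots> = (\<integral>x. indicator (box l u) x \<partial>lborel)"
      using i1 i2 int by (subst Bochner_Integration.integral_add) auto
    also have "\<dots> = (\<Prod>b\<in>Basis. (u - l) \<bullet> b)"
      using lu by (simp add: measure_lborel_box_eq)
    finally show "emeasure (density lborel \<phi>) (box l u) = (\<Prod>b\<in>Basis. (u - l) \<bullet> b)" .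
  qed auto
  then have "density lborel \<phi> = density lborel (\<lambda>x. 1 :: ennreal)"
    by (simp add: density_1)
  then have "AE x in lborel. ennreal (\<phi> x) = 1"
    by (subst (asm) sigma_finite_measure.density_unique_iff[OF sigma_finite_lborel]) auto
  with pos show ?thesis
  proof eventually_elim
    case (elim x)
    then have "\<phi> x = 1" by (simp add: ennreal_eq_1)
    then show ?case using C by (simp add: \<phi>_def)
  qed
qed

text \<open>A limit along one fixed sequence is total and Borel measurable for continuous
  \<open>f\<close>, and it agrees with the directional derivative wherever that exists.\<close>

definition dir_deriv :: "('a::real_normed_vector \<Rightarrow> real) \<Rightarrow> 'a \<Rightarrow> 'a \<Rightarrow> real" where
  "dir_deriv f v x = lim (\<lambda>n. (f (x + inverse (real (Suc n)) *\<^sub>R v) - f x) / inverse (real (Suc n)))"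

lemma dir_deriv_tendsto:
  assumes "((\<lambda>h. (f (x + h *\<^sub>R v) - f x) / h) \<longlongrightarrow> d) (at 0)"
  shows "(\<lambda>n. (f (x + inverse (real (Suc n)) *\<^sub>R v) - f x) / inverse (real (Suc n))) \<longlonglongrightarrow> d"
    and "dir_deriv f v x = d"
proof -
  have "filterlim (\<lambda>n. inverse (real (Suc n))) (at 0) sequentially"
    unfolding filterlim_at by (auto intro: LIMSEQ_inverse_real_of_nat simp del: of_nat_Suc)
  from filterlim_compose[OF assms this]
  show "(\<lambda>n. (f (x + inverse (real (Suc n)) *\<^sub>R v) - f x) / inverse (real (Suc n))) \<longlonglongrightarrow> d" .
  then show "dir_deriv f v x = d"
    unfolding dir_deriv_def by (rule limI)
qed

lemma borel_measurable_dir_deriv: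
  fixes f :: "'a::euclidean_space \<Rightarrow> real"
  assumes "continuous_on UNIV f"
  shows "dir_deriv f v \<in> borel_measurable borel"
proof -
  have "(\<lambda>x. (f (x + inverse (real (Suc n)) *\<^sub>R v) - f x) / inverse (real (Suc n))) \<in> borel_measurable borel" for n
    by (intro borel_measurable_continuous_onI continuous_intros assms continuous_on_compose2[OF assms]) auto
  then show ?thesis
    unfolding dir_deriv_def by (rule borel_measurable_lim_metric)
qed

lemma AE_dir_deriv_tendsto:
  fixes f :: "'a::euclidean_space \<Rightarrow> real"
  assumes L: "L-lipschitz_on UNIV f"
  shows "AE x in lborel. ((\<lambda>h. (f (x + h *\<^sub>R v) - f x) / h) \<longlongrightarrow> dir_deriv f v x) (at 0)"
  using AE_directional_derivative[OF L] by eventually_elim (use dir_deriv_tendsto(2) in blast)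

lemma abs_dir_deriv_le:
  fixes f :: "'a::euclidean_space \<Rightarrow> real"
  assumes L: "L-lipschitz_on UNIV f" and "((\<lambda>h. (f (x + h *\<^sub>R v) - f x) / h) \<longlongrightarrow> dir_deriv f v x) (at 0)"
  shows "\<bar>dir_deriv f v x\<bar> \<le> L * norm v"
  using tendsto_rabs[OF assms(2)]
  by (rule tendsto_upperbound) (use lipschitz_quotient_bound[OF L] in \<open>auto intro!: always_eventually simp del: abs_divide\<close>)

lemma integral_lborel_translate:
  fixes F :: "'a::euclidean_space \<Rightarrow> real"
  assumes "F \<in> borel_measurable borel"
  shows "(\<integral>x. F (c + x) \<partial>lborel) = (\<integral>x. F x \<partial>lborel)"
proof -
  have "(\<integral>x. F x \<partial>distr lborel borel ((+) c)) = (\<integral>x. F (c + x) \<partial>lborel)"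
    using assms by (intro integral_distr) auto
  then show ?thesis unfolding lborel_distr_plus by simp
qed

text \<open>Off the frontier, which is null by convexity, \<open>x\<close> lies in the open box or
  in the open complement of its closure, and small translations change neither.\<close>

lemma AE_indicator_box_tendsto:
  fixes l r u :: "'a::euclidean_space" and e :: "nat \<Rightarrow> real"
  assumes e: "e \<longlonglongrightarrow> 0"
  shows "AE x in lborel. \<forall>\<^sub>F n in sequentially. indicator (box l r) (x - e n *\<^sub>R u) = (indicator (box l r) x :: real)"
proof -
  have "frontier (box l r) \<in> null_sets lborel"
    using negligible_convex_frontier[of "box l r"]
    by (auto simp: negligible_iff_null_sets null_sets_completion_iff)
  then have "AE x in lborel. x \<notin> frontier (box l r)" by (rule AE_not_in)
  then show ?thesis
  proof eventually_elim
    case (elim x)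
    have lim: "(\<lambda>n. x - e n *\<^sub>R u) \<longlonglongrightarrow> x"
      by (rule tendsto_eq_intros e refl)+ simp
    consider "x \<in> box l r" | "x \<in> - closure (box l r)"
      using elim by (auto simp: frontier_def interior_open[OF open_box])
    then show ?case
    proof cases
      case 1
      from topological_tendstoD[OF lim open_box 1] show ?thesis
        by eventually_elim (use 1 in simp)
    next
      case 2
      from topological_tendstoD[OF lim _ 2] have "\<forall>\<^sub>F n in sequentially. x - e n *\<^sub>R u \<in> - closure (box l r)"
        by auto
      then show ?thesis
      proof eventually_elim
        case (elim n)
        then have "x - e n *\<^sub>R u \<notin> box l r" "x \<notin> box l r"
          using 2 closure_subset[of "box l r"] by auto
        then show ?case by simp
      qed
    qed
  qed
qed

text \<open>
  The difference of the two sides is the limit of \<open>q n (x + e n *\<^sub>R u) - q n x\<close>, where \<open>q n\<close> is the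
  bounded difference quotient in the direction \<open>v\<close>. The integral of this over a box is the integral
  of \<open>q n\<close> against the difference of two indicators and hence tends to zero.
\<close>

lemma AE_dir_deriv_add:
  fixes f :: "'a::euclidean_space \<Rightarrow> real"
  assumes L: "L-lipschitz_on UNIV f"
  shows "AE x in lborel. dir_deriv f (u + v) x = dir_deriv f u x + dir_deriv f v x"
proof -
  have L0: "0 \<le> L" using L lipschitz_on_nonneg by blast
  have cont: "continuous_on UNIV f" using L lipschitz_on_continuous_on by blast
  note [measurable] = borel_measurable_dir_deriv[OF cont]
  define e where "e n = inverse (real (Suc n))" for n
  have "e \<longlonglongrightarrow> 0"
    unfolding e_def by (rule LIMSEQ_inverse_real_of_nat)
  moreover have "0 < e n" "e n \<le> 1" for n
    by (auto simp: e_def field_simps)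
  ultimately have e: "e \<longlonglongrightarrow> 0" "0 < e n" "e n \<le> 1" for n
    by auto
  define q where "q n w x = (f (x + e n *\<^sub>R w) - f x) / e n" for n w x
  have [measurable]: "q n w \<in> borel_measurable borel" for n w
    unfolding q_def using e(2)[of n]
    by (intro borel_measurable_continuous_onI continuous_intros cont continuous_on_compose2[OF cont]) auto
  have qb: "\<bar>q n w x\<bar> \<le> L * norm w" for n w x
    unfolding q_def by (rule lipschitz_quotient_bound[OF L])
  have qlim: "(\<lambda>n. q n w x) \<longlonglongrightarrow> dir_deriv f w x"
    if "((\<lambda>h. (f (x + h *\<^sub>R w) - f x) / h) \<longlongrightarrow> dir_deriv f w x) (at 0)" for w x
    using dir_deriv_tendsto(1)[OF that] by (simp add: q_def e_def)
  define g where "g x = dir_deriv f (u + v) x - dir_deriv f u x - dir_deriv f v x" for x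
  have [measurable]: "g \<in> borel_measurable borel" unfolding g_def by measurable
  define C where "C = L * norm (u + v) + L * norm u + L * norm v"
  have C0: "0 \<le> C" using L0 by (simp add: C_def)
  have gae: "AE x in lborel. \<bar>g x\<bar> \<le> C \<and> (\<lambda>n. q n (u + v) x - q n u x - q n v x) \<longlonglongrightarrow> g x"
    using AE_dir_deriv_tendsto[OF L, of "u + v"] AE_dir_deriv_tendsto[OF L, of u] AE_dir_deriv_tendsto[OF L, of v]
  proof eventually_elim
    case (elim x)
    have "\<bar>g x\<bar> \<le> C"
      using elim[THEN abs_dir_deriv_le[OF L]] by (simp add: g_def C_def abs_le_iff)
    then show ?case
      unfolding g_def using elim[THEN qlim] by (auto intro: tendsto_diff)
  qed
  have key: "q n (u + v) x - q n u x - q n v x = q n v (e n *\<^sub>R u + x) - q n v x" for n x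
    using e(2)[of n] by (simp add: q_def scaleR_add_right add_ac field_simps)
  have "AE x in lborel. g x = 0"
  proof (rule AE_zero_of_box_integrals)
    show "AE x in lborel. \<bar>g x\<bar> \<le> C" using gae by eventually_elim simp
    fix l r :: 'a
    let ?S = "box l r" and ?I = "indicator (box l r) :: 'a \<Rightarrow> real"
    have fin: "integrable lborel ?I"
      by (intro integrable_real_indicator) (auto simp: emeasure_lborel_box_eq)
    have fc: "integrable lborel (indicator (cball 0 R) :: 'a \<Rightarrow> real)" if "0 \<le> R" for R
      using that by (intro integrable_real_indicator) (auto simp: emeasure_cball)
    obtain R where R: "?S \<subseteq> cball 0 R" "0 \<le> R"
    proof -
      obtain R where "0 < R" "\<And>x. x \<in> ?S \<Longrightarrow> norm x \<le> R"
        using bounded_box[of l r] unfolding bounded_pos by blast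
      then show thesis by (intro that[of R]) auto
    qed
    have "(\<lambda>n. \<integral>x. ?I x * (q n (u + v) x - q n u x - q n v x) \<partial>lborel) \<longlonglongrightarrow> (\<integral>x. ?I x * g x \<partial>lborel)"
    proof (rule integral_dominated_convergence[where w = "\<lambda>x. C * ?I x"])
      show "AE x in lborel. (\<lambda>n. ?I x * (q n (u + v) x - q n u x - q n v x)) \<longlonglongrightarrow> ?I x * g x"
        using gae by eventually_elim (auto intro: tendsto_mult_left)
      have "\<bar>q n (u + v) x - q n u x - q n v x\<bar> \<le> C" for n x
        using qb[of n "u + v" x] qb[of n u x] qb[of n v x] by (simp add: C_def abs_le_iff)
      then show "AE x in lborel. norm (?I x * (q n (u + v) x - q n u x - q n v x)) \<le> C * ?I x" for n
        by (auto simp: indicator_def)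
    qed (use fin in auto)
    moreover have "(\<integral>x. ?I x * (q n (u + v) x - q n u x - q n v x) \<partial>lborel) =
        (\<integral>x. (?I (x - e n *\<^sub>R u) - ?I x) * q n v x \<partial>lborel)" for n
    proof -
      have int: "integrable lborel (\<lambda>x. h x * q n v (c + x))"
        if h: "h = indicator B" "B \<in> sets borel" "B \<subseteq> cball 0 R'" "0 \<le> R'" for h :: "'a \<Rightarrow> real" and B R' c
      proof (rule Bochner_Integration.integrable_bound[where f = "\<lambda>x. (L * norm v) * indicator (cball 0 R') x :: real"])
        show "AE x in lborel. norm (h x * q n v (c + x)) \<le> norm ((L * norm v) * indicator (cball 0 R') x :: real)"
          using h(3) qb[of n v] L0 by (auto simp: h(1) indicator_def subset_iff)
      qed (use fc[OF h(4)] h in auto)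
      have int1: "integrable lborel (\<lambda>x. ?I x * q n v (c + x))" for c
        by (rule int[of _ ?S R]) (use R in auto)
      have iB: "(\<lambda>x. ?I (x - e n *\<^sub>R u)) = indicator ((+) (e n *\<^sub>R u) ` ?S)"
        by (auto simp: indicator_def fun_eq_iff image_iff algebra_simps)
      have "integrable lborel (\<lambda>x. ?I (x - e n *\<^sub>R u) * q n v (0 + x))"
      proof (rule int[OF iB])
        show "(+) (e n *\<^sub>R u) ` ?S \<in> sets borel" by (intro borel_open open_translation open_box)
        have "norm (e n *\<^sub>R u + x) \<le> norm u + R" if "x \<in> ?S" for x
        proof -
          have "norm (e n *\<^sub>R u + x) \<le> norm (e n *\<^sub>R u) + norm x" by (rule norm_triangle_ineq)
          also have "norm (e n *\<^sub>R u) \<le> norm u" using e(2,3)[of n] by (simp add: mult_left_le_one_le)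
          also have "norm x \<le> R" using R that by auto
          finally show ?thesis by simp
        qed
        then show "(+) (e n *\<^sub>R u) ` ?S \<subseteq> cball 0 (norm u + R)" by auto
      qed (use R in simp)
      then have int2: "integrable lborel (\<lambda>x. ?I (x - e n *\<^sub>R u) * q n v x)" by simp
      have "(\<integral>x. ?I x * (q n (u + v) x - q n u x - q n v x) \<partial>lborel) =
          (\<integral>x. ?I x * q n v (e n *\<^sub>R u + x) - ?I x * q n v x \<partial>lborel)"
        by (simp only: key right_diff_distrib)
      also have "\<dots> = (\<integral>x. ?I x * q n v (e n *\<^sub>R u + x) \<partial>lborel) - (\<integral>x. ?I x * q n v x \<partial>lborel)"
        using int1[of "e n *\<^sub>R u"] int1[of 0] by (intro Bochner_Integration.integral_diff) auto
      also have "(\<integral>x. ?I x * q n v (e n *\<^sub>R u + x) \<partial>lborel) = (\<integral>x. ?I (x - e n *\<^sub>R u) * q n v x \<partial>lborel)"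
        using integral_lborel_translate[of "\<lambda>x. ?I (x - e n *\<^sub>R u) * q n v x" "e n *\<^sub>R u"] by simp
      also have "\<dots> - (\<integral>x. ?I x * q n v x \<partial>lborel) = (\<integral>x. (?I (x - e n *\<^sub>R u) - ?I x) * q n v x \<partial>lborel)"
        using int2 int1[of 0] by (subst Bochner_Integration.integral_diff[symmetric]) (auto simp: left_diff_distrib)
      finally show ?thesis .
    qed
    \<comment> \<open>Because \<open>e n \<le> 1\<close>, the box and all its shifted copies lie in
      the ball of radius \<open>norm u + R\<close>, which carries the dominating function.\<close>
    moreover have "(\<lambda>n. \<integral>x. (?I (x - e n *\<^sub>R u) - ?I x) * q n v x \<partial>lborel) \<longlonglongrightarrow> (\<integral>x. 0 \<partial>(lborel :: 'a measure))"
    proof (rule integral_dominated_convergence[where w = "\<lambda>x. (L * norm v) * indicator (cball 0 (norm u + R)) x"])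
      show "AE x in lborel. (\<lambda>n. (?I (x - e n *\<^sub>R u) - ?I x) * q n v x) \<longlonglongrightarrow> 0"
        using AE_indicator_box_tendsto[OF e(1), of l r u]
      proof eventually_elim
        case (elim x)
        then have "\<forall>\<^sub>F n in sequentially. (?I (x - e n *\<^sub>R u) - ?I x) * q n v x = 0"
          by eventually_elim simp
        then show ?case by (rule tendsto_eventually)
      qed
      have "norm ((?I (x - e n *\<^sub>R u) - ?I x) * q n v x) \<le> (L * norm v) * indicator (cball 0 (norm u + R)) x" for n x
      proof (cases "x \<in> cball 0 (norm u + R)")
        case True
        have "\<bar>?I (x - e n *\<^sub>R u) - ?I x\<bar> \<le> 1" by (simp add: indicator_def)
        then have "\<bar>?I (x - e n *\<^sub>R u) - ?I x\<bar> * \<bar>q n v x\<bar> \<le> 1 * (L * norm v)"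
          using qb[of n v x] by (intro mult_mono) auto
        then show ?thesis using True by (simp add: abs_mult)
      next
        case False
        have "norm x \<le> norm (x - e n *\<^sub>R u) + norm (e n *\<^sub>R u)" by (metis diff_add_cancel norm_triangle_ineq)
        moreover have "norm (e n *\<^sub>R u) \<le> norm u" using e(2,3)[of n] by (simp add: mult_left_le_one_le)
        moreover have "norm u + R < norm x" using False by simp
        ultimately have "\<not> norm (x - e n *\<^sub>R u) \<le> R" "\<not> norm x \<le> R"
          using norm_ge_zero[of u] by linarith+
        then have "x - e n *\<^sub>R u \<notin> ?S" "x \<notin> ?S" using R(1) by (auto simp: subset_iff)
        then show ?thesis using False by simp
      qed
      then show "AE x in lborel. norm ((?I (x - e n *\<^sub>R u) - ?I x) * q n v x)
          \<le> (L * norm v) * indicator (cball 0 (norm u + R)) x" for n by auto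
    qed (use fc R in \<open>auto intro!: integrable_mult_right\<close>)
    ultimately show "(\<integral>x. ?I x * g x \<partial>lborel) = 0"
      by (simp add: LIMSEQ_unique)
  qed (use C0 in auto)
  then show ?thesis by eventually_elim (simp add: g_def)
qed

lemma dir_deriv_scaleR:
  fixes f :: "'a::real_normed_vector \<Rightarrow> real"
  assumes "((\<lambda>h. (f (x + h *\<^sub>R v) - f x) / h) \<longlongrightarrow> dir_deriv f v x) (at 0)"
  shows "dir_deriv f (c *\<^sub>R v) x = c * dir_deriv f v x"
proof (cases "c = 0")
  case True
  then show ?thesis by (simp add: dir_deriv_def lim_const)
next
  case False
  \<comment> \<open>The full limit at 0 is needed: for negative \<open>c\<close> the increment
    \<open>h * c\<close> approaches from the side that the sequence in \<open>dir_deriv\<close>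
    never visits.\<close>
  have "filterlim (\<lambda>h. h * c) (at 0) (at 0)"
    unfolding filterlim_at using False
    by (auto intro!: tendsto_eq_intros simp: eventually_at_filter)
  from tendsto_mult_left[OF filterlim_compose[OF assms this], of c]
  have "((\<lambda>h. c * ((f (x + (h * c) *\<^sub>R v) - f x) / (h * c))) \<longlongrightarrow> c * dir_deriv f v x) (at 0)" .
  moreover have "c * ((f (x + (h * c) *\<^sub>R v) - f x) / (h * c)) = (f (x + h *\<^sub>R c *\<^sub>R v) - f x) / h" for h
    using False by simp
  ultimately show ?thesis by (intro dir_deriv_tendsto(2)) simp
qed

lemma AE_dir_deriv_sum:
  fixes f :: "'a::euclidean_space \<Rightarrow> real"
  assumes L: "L-lipschitz_on UNIV f" and "finite B"
  shows "AE x in lborel. dir_deriv f (\<Sum>b\<in>B. c b *\<^sub>R b) x = (\<Sum>b\<in>B. c b * dir_deriv f b x)"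
  using \<open>finite B\<close>
proof induction
  case empty
  show ?case by (simp add: dir_deriv_def lim_const)
next
  case (insert b B)
  from insert.IH AE_dir_deriv_add[OF L, of "c b *\<^sub>R b" "\<Sum>b\<in>B. c b *\<^sub>R b"] AE_dir_deriv_tendsto[OF L, of b]
  show ?case
  proof eventually_elim
    case (elim x)
    then show ?case using insert.hyps dir_deriv_scaleR[OF elim(3)] by simp
  qed
qed

text \<open>By compactness of the sphere finitely many directions of \<open>Q\<close> approximate
  all unit vectors, so the limits become uniform. Replacing \<open>v\<close> by a nearby
  \<open>q\<close> at distance \<open>h\<close> costs at most
  \<open>(L + norm g) * h * dist q v\<close>.\<close>

lemma has_derivative_of_dense_directions:
  fixes f :: "'a::euclidean_space \<Rightarrow> real"
  assumes L: "L-lipschitz_on UNIV f"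
    and dense: "\<And>U. open U \<Longrightarrow> U \<noteq> {} \<Longrightarrow> \<exists>q\<in>Q. q \<in> U"
    and lim: "\<And>q. q \<in> Q \<Longrightarrow> ((\<lambda>h. (f (x + h *\<^sub>R q) - f x) / h) \<longlongrightarrow> g \<bullet> q) (at 0)"
  shows "(f has_derivative (\<lambda>v. g \<bullet> v)) (at x)"
  unfolding has_derivative_at_alt
proof (intro conjI allI impI bounded_linear_inner_right)
  fix e :: real assume e: "0 < e"
  have L0: "0 \<le> L" using L lipschitz_on_nonneg by blast
  define K where "K = L + norm g + 1"
  have K: "0 < K" using L0 norm_ge_zero[of g] unfolding K_def by linarith
  \<comment> \<open>Half of \<open>e\<close> pays for the change of direction, the other half for
    the finitely many limits.\<close>
  define \<eta> where "\<eta> = e / (2 * K)"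
  have \<eta>: "0 < \<eta>" using e K by (simp add: \<eta>_def)
  have "sphere 0 1 \<subseteq> (\<Union>q\<in>Q. ball q \<eta>)"
  proof
    fix v :: 'a
    obtain q where "q \<in> Q" "q \<in> ball v \<eta>"
      using dense[of "ball v \<eta>"] \<eta> by auto
    then show "v \<in> (\<Union>q\<in>Q. ball q \<eta>)" by (auto simp: dist_commute)
  qed
  then obtain D where D: "D \<subseteq> Q" "finite D" "sphere 0 1 \<subseteq> (\<Union>q\<in>D. ball q \<eta>)"
    using compactE_image[OF compact_sphere, of Q "\<lambda>q. ball q \<eta>" 0 1] by auto
  have "\<forall>\<^sub>F h in at 0. \<forall>q\<in>D. \<bar>(f (x + h *\<^sub>R q) - f x) / h - g \<bullet> q\<bar> < e / 2"
  proof (intro eventually_ball_finite D(2) ballI)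
    fix q assume "q \<in> D"
    then have "((\<lambda>h. (f (x + h *\<^sub>R q) - f x) / h) \<longlongrightarrow> g \<bullet> q) (at 0)" using D lim by auto
    from tendstoD[OF this, of "e / 2"] e show "\<forall>\<^sub>F h in at 0. \<bar>(f (x + h *\<^sub>R q) - f x) / h - g \<bullet> q\<bar> < e / 2"
      by (simp add: dist_real_def)
  qed
  then obtain d where d: "0 < d"
    "\<And>h q. h \<noteq> 0 \<Longrightarrow> \<bar>h\<bar> < d \<Longrightarrow> q \<in> D \<Longrightarrow> \<bar>(f (x + h *\<^sub>R q) - f x) / h - g \<bullet> q\<bar> < e / 2"
    unfolding eventually_at by (auto simp: dist_real_def)
  show "\<exists>d>0. \<forall>y. norm (y - x) < d \<longrightarrow> norm (f y - f x - g \<bullet> (y - x)) \<le> e * norm (y - x)"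
  proof (intro exI[of _ d] conjI allI impI d(1))
    fix y assume y: "norm (y - x) < d"
    show "norm (f y - f x - g \<bullet> (y - x)) \<le> e * norm (y - x)"
    proof (cases "y = x")
      case False
      define h where "h = norm (y - x)"
      define v where "v = (1 / h) *\<^sub>R (y - x)"
      have h: "0 < h" "h < d" using False y by (simp_all add: h_def)
      have v: "norm v = 1" "y = x + h *\<^sub>R v" using h by (simp_all add: v_def h_def)
      obtain q where q: "q \<in> D" "dist q v < \<eta>" using D(3) v by (auto simp: subset_iff)
      have "\<bar>(f (x + h *\<^sub>R q) - f x) / h - g \<bullet> q\<bar> * h < e / 2 * h"
        using d(2)[of h q] h q by (intro mult_strict_right_mono) auto
      also have "\<bar>(f (x + h *\<^sub>R q) - f x) / h - g \<bullet> q\<bar> * h = \<bar>((f (x + h *\<^sub>R q) - f x) / h - g \<bullet> q) * h\<bar>"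
        using h by (simp add: abs_mult)
      also have "((f (x + h *\<^sub>R q) - f x) / h - g \<bullet> q) * h = f (x + h *\<^sub>R q) - f x - h * (g \<bullet> q)"
        using h by (simp add: field_simps)
      finally have 1: "\<bar>f (x + h *\<^sub>R q) - f x - h * (g \<bullet> q)\<bar> < e / 2 * h" .
      have "\<bar>f (x + h *\<^sub>R v) - f (x + h *\<^sub>R q)\<bar> \<le> L * dist (x + h *\<^sub>R v) (x + h *\<^sub>R q)"
        using lipschitz_onD[OF L, of "x + h *\<^sub>R v" "x + h *\<^sub>R q"] by (simp add: dist_real_def)
      also have "dist (x + h *\<^sub>R v) (x + h *\<^sub>R q) = h * dist q v"
        using h by (simp add: dist_norm norm_minus_commute flip: scaleR_diff_right)
      finally have 2: "\<bar>f (x + h *\<^sub>R v) - f (x + h *\<^sub>R q)\<bar> \<le> L * (h * dist q v)" .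
      have "\<bar>g \<bullet> (v - q)\<bar> \<le> norm g * dist q v"
        using Cauchy_Schwarz_ineq2[of g "v - q"] by (simp add: dist_norm norm_minus_commute)
      then have "\<bar>h * (g \<bullet> (v - q))\<bar> \<le> norm g * (h * dist q v)"
        using h by (simp add: abs_mult mult.left_commute)
      then have 3: "\<bar>h * (g \<bullet> v) - h * (g \<bullet> q)\<bar> \<le> norm g * (h * dist q v)"
        by (simp add: inner_diff_right right_diff_distrib)
      have "L * (h * dist q v) + norm g * (h * dist q v) \<le> K * (h * dist q v)"
        using h by (simp add: K_def distrib_right)
      also have "\<dots> \<le> K * (h * \<eta>)"
        using h K q by (intro mult_left_mono) auto
      also have "\<dots> = e / 2 * h" using K by (simp add: \<eta>_def)
      finally have 4: "L * (h * dist q v) + norm g * (h * dist q v) \<le> e / 2 * h" .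
      have "\<bar>f (x + h *\<^sub>R v) - f x - h * (g \<bullet> v)\<bar> \<le> e * h"
        using 1 2 3 4 by linarith
      moreover have "g \<bullet> (y - x) = h * (g \<bullet> v)" using h by (simp add: v_def)
      ultimately show ?thesis by (simp flip: v(2) h_def)
    qed simp
  qed
qed

text \<open>The candidate gradient collects the derivatives along the basis. For each
  \<open>q\<close> almost everywhere additivity identifies the derivative along \<open>q\<close>
  with \<open>g x \<bullet> q\<close>; a countable dense set of directions leaves a single null
  set.\<close>

theorem rademacher:
  fixes f :: "'a::euclidean_space \<Rightarrow> real"
  assumes L: "L-lipschitz_on UNIV f"
  shows "AE x in lborel. f differentiable (at x)"
proof -
  obtain Q :: "'a set" where Q: "countable Q" "\<And>U. open U \<Longrightarrow> U \<noteq> {} \<Longrightarrow> \<exists>q\<in>Q. q \<in> U"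
    using countable_dense_setE by metis
  define g where "g x = (\<Sum>b\<in>Basis. dir_deriv f b x *\<^sub>R b)" for x :: 'a
  have "AE x in lborel. ((\<lambda>h. (f (x + h *\<^sub>R q) - f x) / h) \<longlongrightarrow> g x \<bullet> q) (at 0)" for q
    using AE_dir_deriv_tendsto[OF L, of q] AE_dir_deriv_sum[OF L finite_Basis, of "\<lambda>b. q \<bullet> b"]
  proof eventually_elim
    case (elim x)
    have "dir_deriv f q x = g x \<bullet> q"
      using elim(2) unfolding euclidean_representation
      by (simp add: g_def inner_sum_left inner_commute[of q] mult.commute)
    then show ?case using elim(1) by simp
  qed
  then have "AE x in lborel. \<forall>q\<in>Q. ((\<lambda>h. (f (x + h *\<^sub>R q) - f x) / h) \<longlongrightarrow> g x \<bullet> q) (at 0)"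
    using Q(1) by (simp add: AE_ball_countable)
  then show ?thesis
  proof eventually_elim
    case (elim x)
    have "(f has_derivative (\<lambda>v. g x \<bullet> v)) (at x)"
      by (rule has_derivative_of_dense_directions[OF L Q(2)]) (use elim in auto)
    then show ?case by (rule differentiableI)
  qed
qed

subsection \<open>Lipschitz fields of matrices\<close>

text \<open>A substitute for polar coordinates: Fubini over \<open>(u, t)\<close> provides one
  \<open>t > 0\<close> for which the dilated copy of \<open>Z\<close> is null, and scaling back
  preserves null sets.\<close>

lemma null_sets_lborel_rays:
  fixes Z :: "'a::euclidean_space set"
  assumes Z: "Z \<in> sets borel" and rays: "\<And>u. {t::real. t *\<^sub>R u \<in> Z} \<in> null_sets lborel"
  shows "Z \<in> null_sets lborel"
proof -
  have "AE u in lborel. AE t in lborel. t *\<^sub>R u \<notin> Z"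
    using AE_not_in[OF rays] by simp
  moreover have "{z::'a \<times> real. snd z *\<^sub>R fst z \<notin> Z} \<in> sets borel"
  proof -
    have "(\<lambda>z::'a \<times> real. snd z *\<^sub>R fst z) -` (- Z) \<inter> space borel \<in> sets borel"
      by (rule measurable_sets[OF borel_measurable_continuous_onI]) (use Z in \<open>auto intro!: continuous_intros\<close>)
    then show ?thesis by (simp add: vimage_def)
  qed
  ultimately have "AE t::real in lborel. AE u in lborel. t *\<^sub>R u \<notin> Z"
    by (subst (asm) AE_lborel_commute) auto
  then have "\<exists>t\<in>{0::real<..}. AE u in lborel. t *\<^sub>R u \<notin> Z"
    by (rule AE_lborel_witness) auto
  then obtain t :: real where t: "t > 0" "AE u in lborel. t *\<^sub>R u \<notin> Z"
    by auto
  have "{u. t *\<^sub>R u \<in> Z} \<in> sets borel"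
  proof -
    have "(\<lambda>u. t *\<^sub>R u) -` Z \<inter> space borel \<in> sets borel"
      by (rule measurable_sets[OF borel_measurable_continuous_onI]) (use Z in \<open>auto intro!: continuous_intros\<close>)
    then show ?thesis by (simp add: vimage_def)
  qed
  then have "{u. t *\<^sub>R u \<in> Z} \<in> null_sets lborel"
    using t(2) by (subst AE_iff_null_sets) auto
  then have "negligible {u. t *\<^sub>R u \<in> Z}"
    by (simp add: negligible_iff_null_sets null_sets_completionI)
  then have "negligible ((\<lambda>u. t *\<^sub>R u) ` {u. t *\<^sub>R u \<in> Z})"
    by (intro negligible_differentiable_image_negligible linear_imp_differentiable_on linear_scaleR) auto
  moreover have "(\<lambda>u. t *\<^sub>R u) ` {u. t *\<^sub>R u \<in> Z} = Z"
  proof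
    show "Z \<subseteq> (\<lambda>u. t *\<^sub>R u) ` {u. t *\<^sub>R u \<in> Z}"
      using t(1) by (auto intro!: image_eqI[of _ _ "(1 / t) *\<^sub>R _"])
  qed auto
  ultimately show ?thesis
    using Z by (simp add: negligible_iff_null_sets null_sets_completion_iff)
qed

text \<open>The Leibniz formula is a polynomial in \<open>t\<close> whose value at 0 is the
  determinant of the identity.\<close>

lemma finite_det_zero:
  fixes B :: "real^'n^'n"
  shows "finite {t. det (mat 1 + t *\<^sub>R B) = 0}"
proof -
  define P :: "real poly" where
    "P = (\<Sum>p\<in>{p. p permutes (UNIV :: 'n set)}. [:of_int (sign p):] * (\<Prod>i\<in>UNIV. [:(mat 1 :: real^'n^'n) $ i $ p i, B $ i $ p i:]))"
  have P: "poly P t = det (mat 1 + t *\<^sub>R B)" for t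
    by (simp add: P_def det_def poly_sum poly_prod)
  have "poly P 0 = 1" by (simp add: P det_I)
  then have "P \<noteq> 0" by auto
  then show ?thesis using poly_roots_finite[of P] by (simp add: P)
qed

lemma norm_matrix_vector_le:
  fixes B :: "real^'n^'n"
  shows "norm (B *v u) \<le> (\<Sum>i\<in>UNIV. \<Sum>j\<in>UNIV. \<bar>B $ i $ j\<bar>) * norm u"
proof -
  have "norm (B *v u) \<le> (\<Sum>i\<in>UNIV. \<bar>(B *v u) $ i\<bar>)" by (rule norm_le_l1_cart)
  also have "\<dots> \<le> (\<Sum>i\<in>UNIV. \<Sum>j\<in>UNIV. \<bar>B $ i $ j\<bar> * norm u)"
  proof (rule sum_mono)
    fix i
    have "\<bar>(B *v u) $ i\<bar> \<le> (\<Sum>j\<in>UNIV. \<bar>B $ i $ j * u $ j\<bar>)"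
      by (simp add: matrix_vector_mult_def sum_abs)
    also have "\<dots> \<le> (\<Sum>j\<in>UNIV. \<bar>B $ i $ j\<bar> * norm u)"
      by (intro sum_mono) (simp add: abs_mult mult_left_mono component_le_norm_cart)
    finally show "\<bar>(B *v u) $ i\<bar> \<le> (\<Sum>j\<in>UNIV. \<bar>B $ i $ j\<bar> * norm u)" .
  qed
  finally show ?thesis by (simp add: sum_distrib_right)
qed

text \<open>Here \<open>A\<close> is the matrix field, the \<open>P\<close> of the overview, and
  \<open>flow\<close> is \<Psi>. The assumption is made entrywise because real Lipschitz functions
  extend one at a time.\<close>

locale lipschitz_matrix_field =
  fixes A :: "real^'n \<Rightarrow> real^'n^'n" and L :: real
  assumes lip: "\<And>i j. L-lipschitz_on UNIV (\<lambda>x. A x $ i $ j)"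
begin

definition flow :: "real^'n \<Rightarrow> real^'n \<Rightarrow> real^'n" where
  "flow u x = x + A x *v u"

text \<open>Makes \<open>K * norm u\<close> a Lipschitz constant of \<open>flow u\<close> minus the
  identity.\<close>

definition K :: real where "K = (\<Sum>i\<in>(UNIV::'n set). \<Sum>j\<in>(UNIV::'n set). L)"

lemma K_nonneg: "0 \<le> K"
  unfolding K_def using lipschitz_on_nonneg[OF lip] by (intro sum_nonneg)

lemma flow_diff: "norm (flow u x - flow u y - (x - y)) \<le> K * norm u * norm (x - y)"
proof -
  have "flow u x - flow u y - (x - y) = (A x - A y) *v u"
    by (simp add: flow_def matrix_vector_mult_diff_rdistrib)
  also have "norm \<dots> \<le> (\<Sum>i\<in>UNIV. \<Sum>j\<in>UNIV. \<bar>(A x - A y) $ i $ j\<bar>) * norm u"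
    by (rule norm_matrix_vector_le)
  also have "\<dots> \<le> (\<Sum>i\<in>(UNIV::'n set). \<Sum>j\<in>(UNIV::'n set). L * norm (x - y)) * norm u"
    using lipschitz_onD[OF lip, of x y] by (intro mult_right_mono sum_mono) (auto simp: dist_norm)
  also have "\<dots> = K * norm u * norm (x - y)"
    by (simp add: K_def sum_distrib_right)
  finally show ?thesis .
qed

lemma continuous_flow: "continuous_on UNIV (\<lambda>z. flow (snd z) (fst z))"
proof -
  have "continuous_on UNIV (\<lambda>z::(real^'n) \<times> (real^'n). A (fst z) $ i $ j)" for i j
    using lipschitz_on_continuous_on[OF lip, of i j] by (rule continuous_on_compose2) (auto intro: continuous_intros)
  then have "continuous_on UNIV (\<lambda>z::(real^'n) \<times> (real^'n). A (fst z) $ i $ j * snd z $ j)" for i j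
    by (rule continuous_on_mult) (intro continuous_intros)
  then show ?thesis
    unfolding flow_def matrix_vector_mult_def
    by (intro continuous_on_add continuous_on_fst continuous_on_id continuous_on_vec_lambda continuous_on_sum)
qed

lemma continuous_flow2: "continuous_on UNIV (flow u)"
  by (rule continuous_on_compose2[OF continuous_flow, of UNIV "\<lambda>x. (x, u)", simplified]) (intro continuous_intros)

text \<open>The pairs \<open>(x, u)\<close> for which no linear lower bound on the increments of
  \<open>flow u\<close> holds near \<open>x\<close>. Phrased by increments instead of derivatives,
  the set is Borel, and its complement directly yields the bound that makes the local inverses
  Lipschitz.\<close>

definition degen :: "((real^'n) \<times> (real^'n)) set" where
  "degen = {z. \<forall>n::nat. \<exists>h. h \<noteq> 0 \<and> norm h < inverse (Suc n) \<and>
     norm (flow (snd z) (fst z + h) - flow (snd z) (fst z)) < norm h * inverse (Suc n)}"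

lemma borel_degen: "degen \<in> sets borel"
proof -
  have eq: "degen = (\<Inter>n. \<Union>h\<in>{h. h \<noteq> 0 \<and> norm h < inverse (Suc n)}.
      {z. norm (flow (snd z) (fst z + h) - flow (snd z) (fst z)) < norm h * inverse (Suc n)})"
    unfolding degen_def by auto
  have c: "continuous_on UNIV (\<lambda>z. flow (snd z) (fst z + h))" for h
    by (rule continuous_on_compose2[OF continuous_flow, of UNIV "\<lambda>z. (fst z + h, snd z)", simplified])
      (intro continuous_intros)
  have "open (\<Union>h\<in>{h. h \<noteq> 0 \<and> norm h < inverse (Suc n)}.
      {z. norm (flow (snd z) (fst z + h) - flow (snd z) (fst z)) < norm h * inverse (real (Suc n))})" for n
    by (intro open_UN ballI open_Collect_less continuous_on_norm continuous_on_diff c continuous_flow continuous_on_const)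
  then show ?thesis unfolding eq by (intro sets.countable_INT) auto
qed

text \<open>If \<open>G\<close> is the derivative of the field applied to \<open>u\<close>, then
  \<open>flow (t *\<^sub>R u)\<close> has derivative \<open>1 + t G\<close>. When this is invertible
  it is bounded below by some \<open>c\<close>, and \<open>c / 2\<close> survives the linearization
  error, which excludes degeneracy.\<close>

lemma finite_degen_ray:
  assumes diff: "\<And>i j. (\<lambda>x. A x $ i $ j) differentiable (at x)"
  shows "finite {t. (x, t *\<^sub>R u) \<in> degen}"
proof -
  obtain D where D: "\<And>i j. ((\<lambda>x. A x $ i $ j) has_derivative D i j) (at x)"
    using diff unfolding differentiable_def by metis
  define G where "G v = (\<chi> i. \<Sum>j\<in>UNIV. D i j v * u $ j)" for v
  have G: "((\<lambda>y. A y *v u) has_derivative G) (at x)"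
  proof -
    have "((\<lambda>y. (A y *v u) \<bullet> axis i 1) has_derivative (\<lambda>v. G v \<bullet> axis i 1)) (at x)" for i
      unfolding matrix_vector_mult_def G_def inner_axis
      by (simp, intro has_derivative_sum has_derivative_mult_left D)
    then show ?thesis
      by (subst has_derivative_componentwise_within) (auto simp: Basis_vec_def)
  qed
  then have linG: "linear G" by (rule has_derivative_linear)
  have "det (mat 1 + t *\<^sub>R matrix G) = 0" if deg: "(x, t *\<^sub>R u) \<in> degen" for t
  proof (rule ccontr)
    assume det: "det (mat 1 + t *\<^sub>R matrix G) \<noteq> 0"
    define T where "T v = v + t *\<^sub>R G v" for v
    have T: "T = (\<lambda>v. (mat 1 + t *\<^sub>R matrix G) *v v)"
      using linG by (auto simp: T_def matrix_vector_mult_add_rdistrib scaleR_matrix_vector_assoc[symmetric] matrix_works)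
    have "inj T"
      unfolding T using det by (simp add: invertible_det_nz[symmetric] inj_matrix_vector_mult)
    moreover have linT: "linear T" unfolding T by simp
    ultimately obtain c where c: "c > 0" "\<And>v. c * norm v \<le> norm (T v)"
      using linear_inj_bounded_below_pos by blast
    have "(flow (t *\<^sub>R u) has_derivative T) (at x)"
    proof -
      have "((\<lambda>y. y + t *\<^sub>R (A y *v u)) has_derivative (\<lambda>v. v + t *\<^sub>R G v)) (at x)"
        by (intro has_derivative_add has_derivative_ident has_derivative_scaleR_right G)
      moreover have "flow (t *\<^sub>R u) = (\<lambda>y. y + t *\<^sub>R (A y *v u))"
        by (auto simp: flow_def matrix_vector_mult_scaleR)
      ultimately show ?thesis by (simp add: T_def[abs_def])
    qed
    then obtain d where d: "d > 0" "\<And>y. norm (y - x) < d \<Longrightarrow>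
        norm (flow (t *\<^sub>R u) y - flow (t *\<^sub>R u) x - T (y - x)) \<le> c / 2 * norm (y - x)"
      unfolding has_derivative_at_alt using c(1) by (metis half_gt_zero)
    obtain n :: nat where n: "inverse (real (Suc n)) < min d (c / 2)"
      using reals_Archimedean[of "min d (c / 2)"] d c by auto
    obtain h where h: "h \<noteq> 0" "norm h < inverse (real (Suc n))"
      "norm (flow (t *\<^sub>R u) (x + h) - flow (t *\<^sub>R u) x) < norm h * inverse (real (Suc n))"
      using deg unfolding degen_def by auto
    have 1: "norm (flow (t *\<^sub>R u) (x + h) - flow (t *\<^sub>R u) x - T h) \<le> c / 2 * norm h"
      using d(2)[of "x + h"] h n by simp
    have 2: "norm (T h) \<le> norm (flow (t *\<^sub>R u) (x + h) - flow (t *\<^sub>R u) x)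
        + norm (flow (t *\<^sub>R u) (x + h) - flow (t *\<^sub>R u) x - T h)"
      by (metis diff_diff_eq2 norm_triangle_sub add_diff_cancel_left' norm_minus_commute diff_add_cancel)
    have "norm h * inverse (real (Suc n)) \<le> norm h * (c / 2)"
      using n by (intro mult_left_mono) auto
    then have "norm (T h) < c * norm h"
      using 1 2 h(3) by (simp add: mult.commute)
    then show False using c(2)[of h] by simp
  qed
  then have "{t. (x, t *\<^sub>R u) \<in> degen} \<subseteq> {t. det (mat 1 + t *\<^sub>R matrix G) = 0}" by blast
  then show ?thesis using finite_det_zero finite_subset by blast
qed

text \<open>The exceptional set of Rademacher's theorem is independent of \<open>u\<close>, so rays
  can be used at a fixed \<open>x\<close>; Fubini then passes to a fixed \<open>u\<close>.\<close>

lemma AE_not_degen: "AE u in lborel. AE x in lborel. (x, u) \<notin> degen"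
proof -
  have "AE x in lborel. \<forall>i j. (\<lambda>x. A x $ i $ j) differentiable (at x)"
    using rademacher[OF lip] by (simp add: AE_all_countable)
  then have "AE x in lborel. AE u in lborel. (x, u) \<notin> degen"
  proof eventually_elim
    case (elim x)
    have "{u. (x, u) \<in> degen} \<in> null_sets lborel"
    proof (rule null_sets_lborel_rays)
      have "(\<lambda>u. (x, u)) -` degen \<inter> space borel \<in> sets borel"
        by (rule measurable_sets[OF borel_measurable_continuous_onI borel_degen]) (intro continuous_intros)
      then show "{u. (x, u) \<in> degen} \<in> sets borel" by (simp add: vimage_def)
      show "{t. t *\<^sub>R u \<in> {u. (x, u) \<in> degen}} \<in> null_sets lborel" for u
        using finite_degen_ray[of x u] elim by (auto intro: finite_imp_null_set_lborel)
    qed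
    from AE_not_in[OF this] show ?case by simp
  qed
  moreover have "{z. (fst z, snd z) \<notin> degen} \<in> sets borel"
    using borel_degen sets.compl_sets[OF borel_degen] by (simp add: Compl_eq_Diff_UNIV[symmetric] Compl_eq)
  ultimately show ?thesis
    by (subst (asm) AE_lborel_commute) auto
qed

lemma negligible_flow_preimage:
  assumes deg: "AE x in lborel. (x, u) \<notin> degen" and N: "negligible N"
  shows "negligible {x. flow u x \<in> N}"
proof -
  define E where "E k = {x. flow u x \<in> N \<and>
    (\<forall>h. norm h < inverse (real (Suc k)) \<longrightarrow> norm h * inverse (real (Suc k)) \<le> norm (flow u (x + h) - flow u x))}" for k
  have "negligible (E k)" for k
  proof -
    define r where "r = inverse (real (Suc k))"
    have r: "r > 0" by (simp add: r_def)
    have "\<exists>U. openin (top_of_set (E k)) U \<and> x \<in> U \<and> negligible U" if x: "x \<in> E k" for x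
    proof (intro exI conjI)
      \<comment> \<open>Radius \<open>r / 2\<close> puts any two points of the piece less than
        \<open>r\<close> apart, so the lower bound defining \<open>E k\<close> applies to their
        difference. Local negligibility then takes care of the countable covering.\<close>
      let ?U = "E k \<inter> ball x (r / 2)"
      show "openin (top_of_set (E k)) ?U" by (rule openin_open_Int) simp
      show "x \<in> ?U" using x r by simp
      have lb: "r * norm (y - z) \<le> norm (flow u y - flow u z)" if "y \<in> ?U" "z \<in> ?U" for y z
      proof -
        have "dist z y < r" using that dist_triangle_half_r[of x z r y] by auto
        then have "norm (y - z) < r" by (simp add: dist_norm norm_minus_commute)
        moreover have "\<forall>h. norm h < r \<longrightarrow> norm h * r \<le> norm (flow u (z + h) - flow u z)"
          using that(2) by (simp add: E_def r_def)
        ultimately show ?thesis by (metis add.commute diff_add_cancel mult.commute)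
      qed
      have inj: "inj_on (flow u) ?U"
      proof (rule inj_onI)
        fix y z assume "y \<in> ?U" "z \<in> ?U" "flow u y = flow u z"
        then have "r * norm (y - z) \<le> 0" using lb[of y z] by simp
        then show "y = z" using r by (simp add: mult_le_0_iff)
      qed
      have "negligible (flow u ` ?U)"
        by (rule negligible_subset[OF N]) (auto simp: E_def)
      then have "negligible (inv_into ?U (flow u) ` flow u ` ?U)"
      proof (rule negligible_locally_Lipschitz_image[OF order_refl])
        fix p assume p: "p \<in> flow u ` ?U"
        have "norm (inv_into ?U (flow u) q - inv_into ?U (flow u) p) \<le> (1 / r) * norm (q - p)"
          if "q \<in> flow u ` ?U" for q
        proof -
          have "r * norm (inv_into ?U (flow u) q - inv_into ?U (flow u) p) \<le> norm (q - p)"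
            using lb[OF inv_into_into[OF that] inv_into_into[OF p]] f_inv_into_f[OF that] f_inv_into_f[OF p] by simp
          then show ?thesis using r by (simp add: field_simps)
        qed
        then show "\<exists>T B. open T \<and> p \<in> T \<and>
            (\<forall>y\<in>flow u ` ?U \<inter> T. norm (inv_into ?U (flow u) y - inv_into ?U (flow u) p) \<le> B * norm (y - p))"
          by (intro exI[of _ UNIV] exI[of _ "1 / r"]) auto
      qed
      moreover have "inv_into ?U (flow u) ` flow u ` ?U = ?U"
        by (rule inv_into_image_cancel[OF inj order_refl])
      ultimately show "negligible ?U" by simp
    qed
    then show ?thesis using locally_negligible_alt by blast
  qed
  then have "negligible (\<Union>k. E k)" by (rule negligible_Union_nat)
  moreover have "negligible {x. (x, u) \<in> degen}"
    using deg by (simp add: negligible_iff_null_sets AE_iff_null_sets[symmetric] AE_completion_iff null_sets_completion_iff2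
      eventually_ae_filter subset_eq)
  ultimately have "negligible ((\<Union>k. E k) \<union> {x. (x, u) \<in> degen})" by (rule negligible_Un)
  moreover have "{x. flow u x \<in> N} \<subseteq> (\<Union>k. E k) \<union> {x. (x, u) \<in> degen}"
  proof (intro subsetI)
    fix x assume x: "x \<in> {x. flow u x \<in> N}"
    show "x \<in> (\<Union>k. E k) \<union> {x. (x, u) \<in> degen}"
    proof (cases "(x, u) \<in> degen")
      case False
      then obtain k :: nat where k: "\<forall>h. h \<noteq> 0 \<and> norm h < inverse (real (Suc k)) \<longrightarrow>
          norm h * inverse (real (Suc k)) \<le> norm (flow u (x + h) - flow u x)"
        by (simp only: degen_def mem_Collect_eq not_less[symmetric] fst_conv snd_conv) blast
      have "norm h * inverse (real (Suc k)) \<le> norm (flow u (x + h) - flow u x)"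
        if "norm h < inverse (real (Suc k))" for h
        using k that by (cases "h = 0") auto
      then have "x \<in> E k" using x by (simp add: E_def)
      then show ?thesis by blast
    qed simp
  qed
  ultimately show ?thesis using negligible_subset by blast
qed

lemma AE_flow_avoids_null:
  assumes N: "N \<in> null_sets lborel"
  shows "AE x in lborel. AE u in lborel. flow u x \<notin> N"
proof -
  have N': "negligible N" "N \<in> sets borel" using N by (auto simp: negligible_iff_null_sets null_sets_completionI)
  have B: "{z. flow (snd z) (fst z) \<notin> N} \<in> sets borel"
  proof -
    have "(\<lambda>z. flow (snd z) (fst z)) -` (- N) \<inter> space borel \<in> sets borel"
      by (rule measurable_sets[OF borel_measurable_continuous_onI[OF continuous_flow]]) (use N' in auto)
    then show ?thesis by (simp add: vimage_def)
  qed
  have "AE u in lborel. AE x in lborel. flow u x \<notin> N"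
    using AE_not_degen
  proof eventually_elim
    case (elim u)
    have "{x. flow u x \<in> N} \<in> sets borel"
      using measurable_sets[OF borel_measurable_continuous_onI[OF continuous_flow2, of u] N'(2)] by (simp add: vimage_def)
    then have "{x. flow u x \<in> N} \<in> null_sets lborel"
      using negligible_flow_preimage[OF elim N'(1)] by (simp add: negligible_iff_null_sets null_sets_completion_iff)
    from AE_not_in[OF this] show ?case by simp
  qed
  then show ?thesis using AE_lborel_commute[OF B] by simp
qed

text \<open>
  For small \<open>u\<close> the image of a compact subset \<open>T\<close> of \<open>B\<close> lies in a slightly larger open set and
  has measure at least a fixed fraction of that of \<open>T\<close>, so that it cannot avoid \<open>T\<close>.
\<close>

lemma null_of_AE_flow_avoids:
  assumes B: "B \<in> sets borel" and avoid: "AE x in lborel. x \<in> B \<longrightarrow> (AE u in lborel. flow u x \<notin> B)"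
  shows "B \<in> null_sets lborel"
proof (rule ccontr)
  assume nB: "B \<notin> null_sets lborel"
  have fB: "{z. flow (snd z) (fst z) \<in> B} \<in> sets borel"
    using measurable_sets[OF borel_measurable_continuous_onI[OF continuous_flow] B] by (simp add: vimage_def)
  have B1: "{z :: (real^'n) \<times> (real^'n). fst z \<in> B} \<in> sets borel"
    using measurable_sets[OF borel_measurable_continuous_onI[OF continuous_on_fst[OF continuous_on_id]] B]
    by (simp add: vimage_def)
  have "{z. fst z \<in> B \<longrightarrow> flow (snd z) (fst z) \<notin> B} = - ({z. fst z \<in> B} \<inter> {z. flow (snd z) (fst z) \<in> B})"
    by auto
  then have Bz: "{z. fst z \<in> B \<longrightarrow> flow (snd z) (fst z) \<notin> B} \<in> sets borel"
    using sets.Int[OF B1 fB] by (simp only: borel_comp)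
  have "AE x in lborel. AE u in lborel. x \<in> B \<longrightarrow> flow u x \<notin> B"
    using avoid by eventually_elim auto
  \<comment> \<open>After the exchange a suitable \<open>u\<close> exists in every ball around the
    origin.\<close>
  then have avoid': "AE u in lborel. AE x in lborel. x \<in> B \<longrightarrow> flow u x \<notin> B"
    using AE_lborel_commute[OF Bz] by simp
  have "\<exists>k::nat. B \<inter> cball 0 (real k) \<notin> null_sets lborel"
  proof (rule ccontr)
    assume "\<not> ?thesis"
    then have "(\<Union>k::nat. B \<inter> cball 0 (real k)) \<in> null_sets lborel"
      by (intro null_sets_UN) auto
    moreover have "(\<Union>k::nat. B \<inter> cball 0 (real k)) = B"
      using real_arch_simple by auto
    ultimately show False using nB by simp
  qed
  then obtain k :: nat where k: "B \<inter> cball 0 (real k) \<notin> null_sets lborel" ..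
  define D where "D = cball (0 :: real^'n) (real k)"
  have D: "compact D" "D \<in> sets borel" "emeasure lborel D < \<infinity>"
    by (auto simp: D_def emeasure_cball)
  have "emeasure lborel (B \<inter> D) \<le> emeasure lborel D" using D by (intro emeasure_mono) auto
  then have finBD: "emeasure lborel (B \<inter> D) < \<infinity>" using D(3) by (rule order.strict_trans1)
  define \<beta> where "\<beta> = measure lborel (B \<inter> D)"
  have \<beta>: "emeasure lborel (B \<inter> D) = ennreal \<beta>"
    using finBD by (simp add: \<beta>_def emeasure_eq_ennreal_measure)
  have \<beta>0: "0 < \<beta>"
    using k \<beta> B D by (cases "\<beta> \<le> 0") (auto simp: D_def[symmetric] null_sets_def ennreal_neg)
  have DB: "D - B \<in> sets borel" using B D by auto
  \<comment> \<open>Outer regularity of the complement gives inner approximation: removing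
    \<open>G\<close> from \<open>D\<close> leaves a compact part of \<open>B\<close> and loses less
    than the whole measure \<open>\<beta>\<close>.\<close>
  obtain G where G: "open G" "D - B \<subseteq> G" "emeasure lborel (G - (D - B)) < ennreal \<beta>"
    using outer_regular_lborel[OF DB \<beta>0] by blast
  define T where "T = D - G"
  have T: "compact T" "T \<subseteq> B"
    using D G by (auto simp: T_def compact_diff)
  then have Tb: "T \<in> sets borel" by (simp add: compact_imp_closed)
  have Tpos: "emeasure lborel T \<noteq> 0"
  proof
    assume T0: "emeasure lborel T = 0"
    have "B \<inter> D \<subseteq> T \<union> (G - (D - B))" by (auto simp: T_def)
    then have "emeasure lborel (B \<inter> D) \<le> emeasure lborel (T \<union> (G - (D - B)))"
      using Tb G DB by (intro emeasure_mono) auto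
    also have "\<dots> \<le> emeasure lborel T + emeasure lborel (G - (D - B))"
      using Tb G DB by (intro emeasure_subadditive) auto
    also have "\<dots> < ennreal \<beta>" using T0 G by simp
    finally show False using \<beta> by simp
  qed
  have Tfin: "emeasure lborel T < \<infinity>" using T(1) by (rule emeasure_compact_finite)
  define \<kappa> where "\<kappa> = measure lborel T"
  have \<kappa>: "emeasure lborel T = ennreal \<kappa>"
    using Tfin by (simp add: \<kappa>_def emeasure_eq_ennreal_measure)
  have \<kappa>0: "0 < \<kappa>"
    using Tpos \<kappa> by (cases "\<kappa> \<le> 0") (auto simp: ennreal_neg)
  \<comment> \<open>The distortion factor of a 2-Lipschitz map. The image of \<open>T\<close> will
    have measure at least \<open>\<kappa> / c\<close>, twice the room
    \<open>\<kappa> / (2 * c)\<close> that \<open>U\<close> is allowed outside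
    \<open>T\<close>.\<close>
  define c :: real where "c = (10 * 2) ^ DIM(real^'n)"
  have c: "0 < c" by (simp add: c_def)
  have e0: "0 < \<kappa> / (2 * c)" using \<kappa>0 c by simp
  obtain U where U: "open U" "T \<subseteq> U" "emeasure lborel U \<le> emeasure lborel T + ennreal (\<kappa> / (2 * c))"
    using outer_open_le[OF Tb e0] by blast
  obtain \<epsilon> where \<epsilon>: "\<epsilon> > 0" "(\<Union>x\<in>T. ball x \<epsilon>) \<subseteq> U"
    using compact_subset_open_imp_ball_epsilon_subset[OF T(1) U(1,2)] by blast
  have cA: "continuous_on T (\<lambda>x. \<Sum>i\<in>UNIV. \<Sum>j\<in>UNIV. \<bar>A x $ i $ j\<bar>)"
    using lipschitz_on_continuous_on[OF lip]
    by (intro continuous_on_sum continuous_on_rabs) (auto intro: continuous_on_subset)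
  obtain M where M: "M > 0" "\<And>x. x \<in> T \<Longrightarrow> (\<Sum>i\<in>UNIV. \<Sum>j\<in>UNIV. \<bar>A x $ i $ j\<bar>) \<le> M"
  proof -
    have "bounded ((\<lambda>x. \<Sum>i\<in>UNIV. \<Sum>j\<in>UNIV. \<bar>A x $ i $ j\<bar>) ` T)"
      using compact_continuous_image[OF cA T(1)] by (rule compact_imp_bounded)
    then obtain M where "0 < M" "\<forall>x\<in>T. norm (\<Sum>i\<in>UNIV. \<Sum>j\<in>UNIV. \<bar>A x $ i $ j\<bar>) \<le> M"
      by (auto simp: bounded_pos)
    then show thesis by (intro that[of M]) (auto simp: abs_le_iff)
  qed
  \<comment> \<open>The first bound keeps the image of \<open>T\<close> inside \<open>U\<close>; the
    second makes \<open>flow u\<close> differ from the identity by a map with Lipschitz constant at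
    most 1/2, so both \<open>flow u\<close> and its inverse are 2-Lipschitz.\<close>
  define \<delta> where "\<delta> = min (\<epsilon> / M) (1 / (2 * (K + 1)))"
  have \<delta>: "0 < \<delta>" "M * \<delta> \<le> \<epsilon>" "K * \<delta> \<le> 1 / 2"
  proof -
    show "0 < \<delta>" using \<epsilon> M K_nonneg by (simp add: \<delta>_def)
    have "M * \<delta> \<le> M * (\<epsilon> / M)" using M by (intro mult_left_mono) (auto simp: \<delta>_def)
    then show "M * \<delta> \<le> \<epsilon>" using M by simp
    have "K * \<delta> \<le> K * (1 / (2 * (K + 1)))" using K_nonneg by (intro mult_left_mono) (auto simp: \<delta>_def)
    also have "\<dots> \<le> 1 / 2" using K_nonneg by (simp add: field_simps)
    finally show "K * \<delta> \<le> 1 / 2" .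
  qed
  have "\<exists>u\<in>ball 0 \<delta>. AE x in lborel. x \<in> B \<longrightarrow> flow u x \<notin> B"
    by (rule AE_lborel_witness[OF avoid']) (use \<delta> in auto)
  then obtain u where u: "norm u < \<delta>" "AE x in lborel. x \<in> B \<longrightarrow> flow u x \<notin> B" by auto
  have "K * norm u \<le> K * \<delta>" using u K_nonneg by (intro mult_left_mono) auto
  then have Ku: "K * norm u \<le> 1 / 2" using \<delta>(3) by simp
  have fd: "norm (flow u x - flow u y - (x - y)) \<le> norm (x - y) / 2" for x y
    using order.trans[OF flow_diff[of u x y] mult_right_mono[OF Ku norm_ge_zero]] by simp
  have up: "norm (flow u x - flow u y) \<le> 2 * norm (x - y)" for x y
    using fd[of x y] norm_triangle_sub[of "flow u x - flow u y" "x - y"] norm_ge_zero[of "x - y"] by linarith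
  have low: "norm (x - y) \<le> 2 * norm (flow u x - flow u y)" for x y
    using fd[of x y] norm_triangle_sub[of "x - y" "flow u x - flow u y"]
    by (simp add: norm_minus_commute)
  have lipf: "2-lipschitz_on X (flow u)" for X
    using up by (intro lipschitz_onI) (auto simp: dist_norm)
  have inj: "inj_on (flow u) T"
    using low by (intro inj_onI) (metis diff_self mult_zero_right norm_le_zero_iff norm_zero right_minus_eq)
  define F where "F = flow u ` T"
  have cF: "compact F"
    unfolding F_def using continuous_on_subset[OF continuous_flow2] T(1) by (intro compact_continuous_image) auto
  then have Fb: "F \<in> sets borel" by (simp add: compact_imp_closed)
  have FU: "F \<subseteq> U"
  proof
    fix y assume "y \<in> F"
    then obtain x where x: "x \<in> T" "y = flow u x" by (auto simp: F_def)
    have "norm (A x *v u) \<le> M * norm u"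
      using order.trans[OF norm_matrix_vector_le mult_right_mono[OF M(2)[OF x(1)] norm_ge_zero]] .
    also have "\<dots> < M * \<delta>" using u M by simp
    finally have "y \<in> ball x \<epsilon>" using \<delta>(2) x by (simp add: flow_def dist_norm)
    then show "y \<in> U" using \<epsilon> x by blast
  qed
  \<comment> \<open>The points of \<open>T\<close> that return to \<open>T\<close>. They are null
    because \<open>T\<close> lies in \<open>B\<close>, and therefore so is their image, the overlap
    of \<open>F\<close> and \<open>T\<close>.\<close>
  define N where "N = T \<inter> {x. flow u x \<in> T}"
  have Nb: "N \<in> sets borel"
    using measurable_sets[OF borel_measurable_continuous_onI[OF continuous_flow2, of u] Tb] Tb
    by (auto simp: N_def vimage_def)
  have "AE x in lborel. x \<notin> N"
    using u(2) by eventually_elim (use T in \<open>auto simp: N_def\<close>)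
  then have N0: "emeasure lborel N = 0"
    using AE_iff_null_sets[of N lborel] Nb by auto
  have "emeasure lborel (F \<inter> T) \<le> ennreal ((10 * 2) ^ DIM(real^'n)) * emeasure lborel N"
    by (rule emeasure_lipschitz_image_le[OF Nb _ _ lipf]) (use Fb Tb in \<open>auto simp: F_def N_def\<close>)
  then have FT0: "emeasure lborel (F \<inter> T) = 0" using N0 by simp
  have lipi: "2-lipschitz_on F (inv_into T (flow u))"
  proof (rule lipschitz_onI)
    fix x y assume "x \<in> F" "y \<in> F"
    then have "flow u (inv_into T (flow u) x) = x" "flow u (inv_into T (flow u) y) = y"
      unfolding F_def by (auto simp: f_inv_into_f)
    then show "dist (inv_into T (flow u) x) (inv_into T (flow u) y) \<le> 2 * dist x y"
      using low[of "inv_into T (flow u) x" "inv_into T (flow u) y"] by (simp add: dist_norm)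
  qed simp
  have "T \<subseteq> inv_into T (flow u) ` F"
    unfolding F_def using inv_into_image_cancel[OF inj order_refl] by simp
  then have "emeasure lborel T \<le> ennreal c * emeasure lborel F"
    unfolding c_def by (intro emeasure_lipschitz_image_le[OF Fb Tb _ lipi])
  moreover define \<phi> where "\<phi> = measure lborel F"
  have \<phi>: "emeasure lborel F = ennreal \<phi>" "0 \<le> \<phi>"
    using emeasure_compact_finite[OF cF] by (auto simp: \<phi>_def emeasure_eq_ennreal_measure)
  ultimately have "ennreal \<kappa> \<le> ennreal (c * \<phi>)"
    using \<kappa> c by (simp add: ennreal_mult')
  then have k1: "\<kappa> \<le> c * \<phi>" using \<phi> c by simp
  have "emeasure lborel F = emeasure lborel (F \<inter> T) + emeasure lborel (F - T)"
    using Fb Tb by (subst plus_emeasure) (auto intro!: arg_cong[where f = "emeasure lborel"])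
  then have "emeasure lborel F = emeasure lborel (F - T)" using FT0 by simp
  \<comment> \<open>\<open>T\<close> and \<open>F\<close> are disjoint up to a null set and both lie
    in \<open>U\<close>, so \<open>F\<close> would have to fit into the room left outside
    \<open>T\<close>.\<close>
  then have "emeasure lborel T + emeasure lborel F = emeasure lborel (T \<union> (F - T))"
    using Fb Tb by (simp add: plus_emeasure)
  also have "\<dots> \<le> emeasure lborel U"
    using U FU by (intro emeasure_mono) auto
  also have "\<dots> \<le> emeasure lborel T + ennreal (\<kappa> / (2 * c))" by (rule U(3))
  finally have "ennreal (\<kappa> + \<phi>) \<le> ennreal (\<kappa> + \<kappa> / (2 * c))"
    using \<kappa> \<phi> \<kappa>0 c by (simp add: ennreal_plus)
  then have "\<phi> \<le> \<kappa> / (2 * c)"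
    using \<kappa>0 c by (subst (asm) ennreal_le_iff) auto
  then have "c * \<phi> \<le> \<kappa> / 2" using c by (simp add: field_simps)
  with k1 \<kappa>0 show False by simp
qed

end

section \<open>Extension of the field from \<open>S\<close> and the equivalence of the three
  conditions\<close>

lemma lipschitz_on_extension:
  fixes f :: "'a::metric_space \<Rightarrow> real"
  assumes L: "L-lipschitz_on S f"
  shows "\<exists>g. L-lipschitz_on UNIV g \<and> (\<forall>x\<in>S. g x = f x)"
proof (cases "S = {}")
  case True
  then show ?thesis
    using lipschitz_on_nonneg[OF L] by (intro exI[of _ "\<lambda>_. 0"]) (auto intro: lipschitz_onI)
next
  case False
  have L0: "0 \<le> L" using L lipschitz_on_nonneg by blast
  \<comment> \<open>McShane's formula, the largest extension with constant \<open>L\<close>; the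
    infimum requires a nonempty \<open>S\<close>.\<close>
  define g where "g y = (INF x\<in>S. f x + L * dist x y)" for y
  have fL: "f x \<le> f z + L * dist x z" if "x \<in> S" "z \<in> S" for x z
    using lipschitz_onD[OF L that] by (simp add: dist_real_def abs_le_iff)
  have lower: "f z - L * dist z y \<le> f x + L * dist x y" if "x \<in> S" "z \<in> S" for x y z
  proof -
    have "L * dist z x \<le> L * (dist z y + dist x y)"
      using L0 dist_triangle2[of z x y] by (intro mult_left_mono) auto
    then show ?thesis using fL[OF that(2,1)] by (simp add: distrib_left)
  qed
  have bdd: "bdd_below ((\<lambda>x. f x + L * dist x y) ` S)" for y
  proof -
    from False obtain z where "z \<in> S" by blast
    then show ?thesis using lower by (intro bdd_belowI2[of S "f z - L * dist z y"])
  qed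
  have gL: "g y \<le> g z + L * dist y z" for y z
  proof -
    have "g y - L * dist y z \<le> f x + L * dist x z" if "x \<in> S" for x
    proof -
      have "g y \<le> f x + L * dist x y"
        unfolding g_def by (rule cINF_lower[OF bdd that])
      also have "L * dist x y \<le> L * (dist x z + dist y z)"
        using L0 dist_triangle2[of x y z] by (intro mult_left_mono) auto
      finally show ?thesis by (simp add: distrib_left)
    qed
    then have "g y - L * dist y z \<le> g z"
      unfolding g_def[of z] by (intro cINF_greatest False)
    then show ?thesis by simp
  qed
  have "L-lipschitz_on UNIV g"
  proof (rule lipschitz_onI)
    show "dist (g x) (g y) \<le> L * dist x y" for x y
      using gL[of x y] gL[of y x] by (simp add: dist_real_def abs_le_iff dist_commute)
  qed (rule L0)
  moreover have "g x = f x" if "x \<in> S" for x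
  proof (rule antisym)
    show "g x \<le> f x" unfolding g_def using cINF_lower[OF bdd that, of x] by simp
    show "f x \<le> g x"
      unfolding g_def
    proof (intro cINF_greatest False)
      show "f x \<le> f z + L * dist z x" if "z \<in> S" for z
        using fL[OF \<open>x \<in> S\<close> that] by (simp add: dist_commute)
    qed
  qed
  ultimately show ?thesis by blast
qed

lemma norm_orth_proj_diff_le: "norm (orth_proj V x - orth_proj W x) \<le> grassmannian_dist V W * norm x"
proof -
  have "bounded_linear (\<lambda>x. orth_proj V x - orth_proj W x)"
    by (intro linear_linear[THEN iffD2] linear_compose_sub linear_orth_proj)
  then show ?thesis unfolding grassmannian_dist_def by (rule onorm)
qed

theorem theorem7p1:
  fixes S A :: "(real ^ 'n) set"
    and W0 W :: "real ^ 'n \<Rightarrow> (real ^ 'n) set"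
    and m :: nat
  assumes "1 \<le> m" and "m \<le> CARD('n) - 1"
    and "Lipschitz_continuous_map (submetric euclidean_metric S) (grassmannian_metric m) W0"
    and "A \<subseteq> S" and "A \<in> sets borel"
    and "\<And>x. x \<in> S \<Longrightarrow> W x = (+) x ` W0 x"
  shows "(outer_measure_of lborel A = 0 \<longleftrightarrow> ae_on A (\<lambda>x. hausdorff_measure m (A \<inter> W x) = 0))
       \<and> (outer_measure_of lborel A = 0 \<longleftrightarrow> ae_on S (\<lambda>x. hausdorff_measure m (A \<inter> W x) = 0))"
proof -
  have W0: "subspace (W0 x)" "dim (W0 x) = m" if "x \<in> S" for x
    using Lipschitz_continuous_map_image[OF assms(3)] that by (auto simp: grassmannian_def Pi_iff)
  obtain C where C: "\<And>x y. x \<in> S \<Longrightarrow> y \<in> S \<Longrightarrow> grassmannian_dist (W0 x) (W0 y) \<le> C * dist x y"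
    using assms(3) by (auto simp: Lipschitz_continuous_map_def)
  \<comment> \<open>\<open>axis j 1\<close> is a unit vector, so a matrix entry changes by at most
    the operator norm. The absolute value covers a negative \<open>C\<close>, possible when
    \<open>S\<close> has at most one point.\<close>
  have "\<bar>C\<bar>-lipschitz_on S (\<lambda>x. orth_proj (W0 x) (axis j 1) $ i)" for i j
  proof (rule lipschitz_onI)
    fix x y assume xy: "x \<in> S" "y \<in> S"
    have "dist (orth_proj (W0 x) (axis j 1) $ i) (orth_proj (W0 y) (axis j 1) $ i)
        \<le> norm (orth_proj (W0 x) (axis j 1) - orth_proj (W0 y) (axis j 1))"
      using component_le_norm_cart[of "orth_proj (W0 x) (axis j 1) - orth_proj (W0 y) (axis j 1)" i]
      by (simp add: dist_real_def)
    also have "\<dots> \<le> grassmannian_dist (W0 x) (W0 y)"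
      using norm_orth_proj_diff_le[of "W0 x" "axis j 1" "W0 y"] by simp
    also have "\<dots> \<le> C * dist x y" by (rule C[OF xy])
    also have "\<dots> \<le> \<bar>C\<bar> * dist x y" by (intro mult_right_mono) auto
    finally show "dist (orth_proj (W0 x) (axis j 1) $ i) (orth_proj (W0 y) (axis j 1) $ i) \<le> \<bar>C\<bar> * dist x y" .
  qed simp
  then have ex: "\<exists>g. \<bar>C\<bar>-lipschitz_on UNIV g \<and> (\<forall>x\<in>S. g x = orth_proj (W0 x) (axis j 1) $ i)" for i j
    by (rule lipschitz_on_extension)
  define g where "g i j = (SOME g. \<bar>C\<bar>-lipschitz_on UNIV g \<and> (\<forall>x\<in>S. g x = orth_proj (W0 x) (axis j 1) $ i))" for i j
  have g: "\<bar>C\<bar>-lipschitz_on UNIV (g i j)" "x \<in> S \<Longrightarrow> g i j x = orth_proj (W0 x) (axis j 1) $ i" for i j x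
    using someI_ex[OF ex[of j i]] unfolding g_def by blast+
  define P where "P x = (\<chi> i j. g i j x)" for x
  interpret lipschitz_matrix_field P "\<bar>C\<bar>"
    by unfold_locales (simp add: P_def g(1))
  have flow: "flow u x = x + orth_proj (W0 x) u" if "x \<in> S" for u x
  proof -
    have "P x = matrix (orth_proj (W0 x))"
      using g(2)[OF that] by (simp add: P_def matrix_def)
    then show ?thesis using linear_orth_proj[of "W0 x"] by (simp add: flow_def matrix_works)
  qed
  \<comment> \<open>This equivalence carries conditions (2) and (3) over to the field. As
    \<open>A\<close> is Borel, the set of bad \<open>u\<close> is measurable and its negligibility
    is an \<open>AE\<close> statement.\<close>
  have H: "hausdorff_measure m (A \<inter> W x) = 0 \<longleftrightarrow> (AE u in lborel. flow u x \<notin> A)" if x: "x \<in> S" for x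
  proof -
    have span: "span (W0 x) = W0 x" using W0(1)[OF x] by simp
    have Pin: "orth_proj (W0 x) u \<in> W0 x" for u
      using orth_proj_in_span[of "W0 x" u] unfolding span .
    have eq: "{u. x + orth_proj (W0 x) u \<in> A \<inter> W x} = {u. flow u x \<in> A}"
      using Pin by (auto simp: flow[OF x] assms(6)[OF x])
    have bor: "{u. flow u x \<in> A} \<in> sets borel"
    proof -
      have "continuous_on UNIV (\<lambda>u. flow u x)"
        by (rule continuous_on_compose2[OF continuous_flow, of UNIV "\<lambda>u. (x, u)", simplified])
          (intro continuous_intros)
      from measurable_sets[OF borel_measurable_continuous_onI[OF this] assms(5)]
      show ?thesis by (simp add: vimage_def)
    qed
    have "hausdorff_measure m (A \<inter> W x) = 0 \<longleftrightarrow> negligible {u. flow u x \<in> A}"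
      using negligible_of_hausdorff_null[OF W0[OF x], of "A \<inter> W x" x]
        hausdorff_null_of_negligible[OF W0[OF x], of "A \<inter> W x" x]
      unfolding eq by (auto simp: assms(6)[OF x])
    also have "\<dots> \<longleftrightarrow> {u. flow u x \<in> A} \<in> null_sets lborel"
      using bor by (simp add: negligible_iff_null_sets null_sets_completion_iff)
    also have "\<dots> \<longleftrightarrow> (AE u in lborel. flow u x \<notin> A)"
      using AE_iff_null_sets[of "{u. flow u x \<in> A}" lborel] bor by simp
    finally show ?thesis .
  qed
  have A0: "outer_measure_of lborel A = 0 \<longleftrightarrow> A \<in> null_sets lborel"
    using assms(5) by (auto simp: null_sets_def)
  have 13: "ae_on S (\<lambda>x. hausdorff_measure m (A \<inter> W x) = 0)" if "outer_measure_of lborel A = 0"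
  proof -
    have "AE x in lborel. AE u in lborel. flow u x \<notin> A"
      using that by (intro AE_flow_avoids_null) (simp add: A0)
    then obtain N where N: "{x. \<not> (AE u in lborel. flow u x \<notin> A)} \<subseteq> N" "emeasure lborel N = 0" "N \<in> sets lborel"
      by (auto elim: AE_E)
    have "outer_measure_of lborel (N \<inter> S) \<le> outer_measure_of lborel N"
      by (rule outer_measure_of_mono) auto
    then have "outer_measure_of lborel (N \<inter> S) = 0" using N by simp
    then show ?thesis
      unfolding ae_on_def using N(1) H by (intro exI[of _ "N \<inter> S"]) auto
  qed
  have 32: "ae_on A Q" if Q: "ae_on S Q" for Q
  proof -
    obtain N where N: "N \<subseteq> S" "outer_measure_of lborel N = 0" "\<forall>x\<in>S - N. Q x"
      using Q by (auto simp: ae_on_def)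
    have "outer_measure_of lborel (N \<inter> A) \<le> outer_measure_of lborel N"
      by (rule outer_measure_of_mono) auto
    then show ?thesis
      unfolding ae_on_def using N assms(4) by (intro exI[of _ "N \<inter> A"]) auto
  qed
  have 21: "outer_measure_of lborel A = 0" if Q: "ae_on A (\<lambda>x. hausdorff_measure m (A \<inter> W x) = 0)"
  proof -
    obtain N where N: "N \<subseteq> A" "negligible N" "\<forall>x\<in>A - N. hausdorff_measure m (A \<inter> W x) = 0"
      using Q by (auto simp: ae_on_def negligible_iff_outer_measure_of)
    \<comment> \<open>The exceptional set \<open>N\<close> may fail to be Borel; a Borel null set
      containing it is needed to work with \<open>AE\<close>.\<close>
    then obtain N' where N': "N' \<in> null_sets lborel" "N \<subseteq> N'"
      by (auto simp: negligible_iff_null_sets null_sets_completion_iff2)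
    have "AE x in lborel. x \<in> A \<longrightarrow> (AE u in lborel. flow u x \<notin> A)"
      using AE_not_in[OF N'(1)]
    proof eventually_elim
      case (elim x)
      then show ?case using N(3) N'(2) H assms(4) by blast
    qed
    then show ?thesis
      using null_of_AE_flow_avoids[OF assms(5)] A0 by blast
  qed
  show ?thesis using 13 32 21 by blast
qed

end
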